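(* Let $$\chi_0=\kappa\left(\frac{\rho_2}{b}-\frac{\rho_1}{\kappa}\right)\left(\rho_3-\frac{\rho_2}{b\tau}\right)+\frac{m^2\rho_2}{b},\qquad \chi_1=-m^2-\kappa\rho_3+\frac{\kappa\rho_2}{\tau b}.$$ If either $\chi_0\ne0$, or $\chi_0=0$ and $\chi_1=0$, then the $C_0$-semigroup $\{e^{\mathcal{A}_1t}\}_{t\ge0}$ generated by $\mathcal{A}_1$ on $\mathcal{H}_1$ is not exponentially stable.
   Context: Let $L>0$, let $\rho,\rho_1,\rho_2,\rho_3,\alpha,\kappa,b,\tau,\sigma,\beta,\gamma>0$ and $m\in\mathbb{R}\setminus\{0\}$ be constants. All functions are complex-valued on $(0,L)$; $L^2=L^2(0,L)$, $H^1=H^1(0,L)$, $H^2=H^2(0,L)$, $H_0^1=H_0^1(0,L)$; $(\cdot,\cdot)$ and $\|\cdot\|$ denote the inner product and norm of $L^2$. Let $L_*^2=\{\omega\in L^2:\int_0^L\omega\,dx=0\}$ and $H_*^1=H^1\cap L_*^2$. Put $$\mathcal{H}_1=H_*^1\times L_*^2\times H_*^1\times L_*^2\times H_0^1\times L^2\times L^2\times L^2,$$ with elements $U=(u,v,\varphi,\Phi,\psi,\Psi,\theta,q)$; it is a Hilbert space with the inner product inducing the norm $$\|U\|_{\mathcal{H}_1}^2=\rho\|v\|^2+\alpha\|u_x\|^2+\rho_1\|\Phi\|^2+\rho_2\|\Psi\|^2+b\|\psi_x\|^2+\beta\|\varphi-u\|^2+\kappa\|\varphi_x+\psi\|^2+\rho_3\|\theta\|^2+\tau\|q\|^2.$$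 The linear operator $\mathcal{A}_1$ has domain $$\mathcal{D}(\mathcal{A}_1)=\{U\in\mathcal{H}_1: v,\Phi\in H_*^1;\ u_x,\varphi_x,\theta,\Psi\in H_0^1;\ \psi\in H^2;\ q\in H^1\}$$ and is given by $$\mathcal{A}_1U=\begin{pmatrix} v\\ \rho^{-1}[\alpha u_{xx}+\beta(\varphi-u)-\gamma v]\\ \Phi\\ \rho_1^{-1}[\kappa(\varphi_x+\psi)_x-\beta(\varphi-u)-m\theta_x]\\ \Psi\\ \rho_2^{-1}[b\psi_{xx}-\kappa(\varphi_x+\psi)+m\theta]\\ \rho_3^{-1}[-q_x-m(\Phi_x+\Psi)]\\ \tau^{-1}(-\sigma q-\theta_x)\end{pmatrix}.$$ It generates a $C_0$-semigroup of contractions on $\mathcal{H}_1$. A $C_0$-semigroup $\{e^{\mathcal{A}t}\}_{t\ge0}$ on a Hilbert space $X$ is exponentially stable if there are constants $M,\omega>0$ with $\|e^{\mathcal{A}t}\|_{\mathcal{L}(X\to X)}\le Me^{-\omega t}$ for all $t\ge0$. *)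

theory Defs
  imports "HOL-Analysis.Analysis"
begin

section \<open>Complex vector spaces\<close>

class complex_vector = real_vector +
  fixes scaleC :: "complex \<Rightarrow> 'a \<Rightarrow> 'a"  (infixr \<open>*\<^sub>C\<close> 75)
  assumes scaleR_scaleC: "r *\<^sub>R x = complex_of_real r *\<^sub>C x"
    and scaleC_add_right: "a *\<^sub>C (x + y) = a *\<^sub>C x + a *\<^sub>C y"
    and scaleC_add_left: "(a + b) *\<^sub>C x = a *\<^sub>C x + b *\<^sub>C x"
    and scaleC_scaleC: "a *\<^sub>C b *\<^sub>C x = (a * b) *\<^sub>C x"

instantiation prod :: (complex_vector, complex_vector) complex_vector
begin

definition scaleC_prod_def: "c *\<^sub>C p = (c *\<^sub>C fst p, c *\<^sub>C snd p)"

instance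
  by standard
    (auto simp: scaleC_prod_def scaleR_prod_def scaleR_scaleC scaleC_add_right scaleC_add_left
      scaleC_scaleC)

end

section \<open>The space of square-integrable functions\<close>

definition square_integrable :: "(real \<Rightarrow> complex) \<Rightarrow> bool" where
  "square_integrable f \<longleftrightarrow>
     f \<in> borel_measurable lborel \<and> integrable lborel (\<lambda>x. (cmod (f x))\<^sup>2)"

definition L2_rel :: "(real \<Rightarrow> complex) \<Rightarrow> (real \<Rightarrow> complex) \<Rightarrow> bool" where
  "L2_rel f g \<longleftrightarrow>
     square_integrable f \<and> square_integrable g \<and> (AE x in lborel. f x = g x)"

lemma L2_relI:
  assumes "square_integrable f" and "\<And>x. f x = g x"
  shows "L2_rel f g"
proof -
  from assms(2) have "g = f"
    by (simp add: fun_eq_iff)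
  with assms(1) show ?thesis
    by (simp add: L2_rel_def)
qed

lemma square_integrable_zero: "square_integrable (\<lambda>_. 0)"
  by (simp add: square_integrable_def)

lemma square_integrable_measurable [measurable_dest]:
  "square_integrable f \<Longrightarrow> f \<in> borel_measurable lborel"
  by (simp add: square_integrable_def)

lemma square_integrable_scale:
  assumes "square_integrable f"
  shows "square_integrable (\<lambda>x. c * f x)"
  using assms by (auto simp: square_integrable_def norm_mult power_mult_distrib)

lemma square_integrable_add:
  assumes "square_integrable f" "square_integrable g"
  shows "square_integrable (\<lambda>x. f x + g x)"
proof -
  have [measurable]: "f \<in> borel_measurable lborel" "g \<in> borel_measurable lborel"
    using assms by (auto simp: square_integrable_def)
  have *: "(cmod (a + b))\<^sup>2 \<le> 2 * (cmod a)\<^sup>2 + 2 * (cmod b)\<^sup>2" for a b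
  proof -
    have "(cmod (a + b))\<^sup>2 \<le> (cmod a + cmod b)\<^sup>2"
      by (intro power_mono norm_triangle_ineq) auto
    also have "\<dots> \<le> 2 * (cmod a)\<^sup>2 + 2 * (cmod b)\<^sup>2"
      using sum_squares_bound[of "cmod a" "cmod b"] by (simp add: power2_sum)
    finally show ?thesis .
  qed
  have "integrable lborel (\<lambda>x. 2 * (cmod (f x))\<^sup>2 + 2 * (cmod (g x))\<^sup>2)"
    using assms by (auto simp: square_integrable_def)
  then have "integrable lborel (\<lambda>x. (cmod (f x + g x))\<^sup>2)"
    by (rule Bochner_Integration.integrable_bound) (auto intro: *)
  then show ?thesis
    by (simp add: square_integrable_def)
qed

lemma square_integrable_uminus: "square_integrable f \<Longrightarrow> square_integrable (\<lambda>x. - f x)"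
  using square_integrable_scale[of f "-1"] by simp

lemma square_integrable_diff:
  "square_integrable f \<Longrightarrow> square_integrable g \<Longrightarrow> square_integrable (\<lambda>x. f x - g x)"
  using square_integrable_add[OF _ square_integrable_uminus, of f g] by simp

lemma integrable_inner_square_integrable:
  assumes "square_integrable f" "square_integrable g"
  shows "integrable lborel (\<lambda>x. f x \<bullet> g x)"
proof -
  have [measurable]: "f \<in> borel_measurable lborel" "g \<in> borel_measurable lborel"
    using assms by (auto simp: square_integrable_def)
  have *: "\<bar>a \<bullet> b\<bar> \<le> (cmod a)\<^sup>2 + (cmod b)\<^sup>2" for a b
  proof -
    have "\<bar>a \<bullet> b\<bar> \<le> cmod a * cmod b"
      by (rule Cauchy_Schwarz_ineq2)
    also have "\<dots> \<le> (cmod a)\<^sup>2 + (cmod b)\<^sup>2"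
      using sum_squares_bound[of "cmod a" "cmod b"] mult_nonneg_nonneg[of "cmod a" "cmod b"]
      by (simp del: mult_nonneg_nonneg)
    finally show ?thesis .
  qed
  have "integrable lborel (\<lambda>x. (cmod (f x))\<^sup>2 + (cmod (g x))\<^sup>2)"
    using assms by (auto simp: square_integrable_def)
  then show ?thesis
    by (rule Bochner_Integration.integrable_bound) (auto intro: *)
qed

quotient_type L2 = "real \<Rightarrow> complex" / partial: L2_rel
proof (rule part_equivpI)
  show "\<exists>f. L2_rel f f"
    using square_integrable_zero by (auto simp: L2_rel_def)
  show "symp L2_rel"
    by (auto simp: symp_def L2_rel_def)
  show "transp L2_rel"
    by (auto simp: transp_def L2_rel_def)
qed

instantiation L2 :: complex_vector
begin

lift_definition zero_L2 :: L2 is "\<lambda>_. 0"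
  by (auto simp: L2_rel_def square_integrable_zero)

lift_definition plus_L2 :: "L2 \<Rightarrow> L2 \<Rightarrow> L2" is "\<lambda>f g x. f x + g x"
  by (auto simp: L2_rel_def square_integrable_add)

lift_definition minus_L2 :: "L2 \<Rightarrow> L2 \<Rightarrow> L2" is "\<lambda>f g x. f x - g x"
  by (auto simp: L2_rel_def square_integrable_diff)

lift_definition uminus_L2 :: "L2 \<Rightarrow> L2" is "\<lambda>f x. - f x"
  by (auto simp: L2_rel_def square_integrable_uminus)

lift_definition scaleC_L2 :: "complex \<Rightarrow> L2 \<Rightarrow> L2" is "\<lambda>c f x. c * f x"
  by (auto simp: L2_rel_def square_integrable_scale)

lift_definition scaleR_L2 :: "real \<Rightarrow> L2 \<Rightarrow> L2" is "\<lambda>r f x. complex_of_real r * f x"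
  by (auto simp: L2_rel_def square_integrable_scale)

instance
proof
  fix f g h :: L2 and a b :: complex and r s :: real
  note [intro] = square_integrable_zero square_integrable_add square_integrable_diff
    square_integrable_uminus square_integrable_scale
  show "f + g + h = f + (g + h)"
    by transfer (rule L2_relI, auto simp: L2_rel_def)
  show "f + g = g + f"
    by transfer (rule L2_relI, auto simp: L2_rel_def)
  show "0 + f = f"
    by transfer (rule L2_relI, auto simp: L2_rel_def)
  show "- f + f = 0"
    by transfer (rule L2_relI, auto simp: L2_rel_def)
  show "f - g = f + - g"
    by transfer (rule L2_relI, auto simp: L2_rel_def)
  show "r *\<^sub>R (f + g) = r *\<^sub>R f + r *\<^sub>R g"
    by transfer (rule L2_relI, auto simp: L2_rel_def distrib_left)
  show "(r + s) *\<^sub>R f = r *\<^sub>R f + s *\<^sub>R f"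
    by transfer (rule L2_relI, auto simp: L2_rel_def distrib_right)
  show "r *\<^sub>R s *\<^sub>R f = (r * s) *\<^sub>R f"
    by transfer (rule L2_relI, auto simp: L2_rel_def)
  show "1 *\<^sub>R f = f"
    by transfer (rule L2_relI, auto simp: L2_rel_def)
  show "r *\<^sub>R f = complex_of_real r *\<^sub>C f"
    by transfer (rule L2_relI, auto simp: L2_rel_def)
  show "a *\<^sub>C (f + g) = a *\<^sub>C f + a *\<^sub>C g"
    by transfer (rule L2_relI, auto simp: L2_rel_def distrib_left)
  show "(a + b) *\<^sub>C f = a *\<^sub>C f + b *\<^sub>C f"
    by transfer (rule L2_relI, auto simp: L2_rel_def distrib_right)
  show "a *\<^sub>C b *\<^sub>C f = (a * b) *\<^sub>C f"
    by transfer (rule L2_relI, auto simp: L2_rel_def)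
qed

end

instantiation L2 :: real_inner
begin

lift_definition inner_L2 :: "L2 \<Rightarrow> L2 \<Rightarrow> real" is "\<lambda>f g. LINT x|lborel. f x \<bullet> g x"
proof -
  fix f f' g g' :: "real \<Rightarrow> complex"
  assume "L2_rel f f'" "L2_rel g g'"
  then have "f \<in> borel_measurable lborel" "f' \<in> borel_measurable lborel"
      "g \<in> borel_measurable lborel" "g' \<in> borel_measurable lborel"
      "AE x in lborel. f x = f' x" "AE x in lborel. g x = g' x"
    by (auto simp: L2_rel_def square_integrable_def)
  then show "(LINT x|lborel. f x \<bullet> g x) = (LINT x|lborel. f' x \<bullet> g' x)"
    by (intro integral_cong_AE) auto
qed

definition norm_L2 :: "L2 \<Rightarrow> real" where "norm_L2 f = sqrt (f \<bullet> f)"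
definition dist_L2 :: "L2 \<Rightarrow> L2 \<Rightarrow> real" where "dist_L2 f g = norm (f - g)"
definition sgn_L2 :: "L2 \<Rightarrow> L2" where "sgn_L2 f = inverse (norm f) *\<^sub>R f"
definition uniformity_L2 :: "(L2 \<times> L2) filter" where
  "uniformity_L2 = (INF e\<in>{0<..}. principal {(f, g). dist f g < e})"
definition open_L2 :: "L2 set \<Rightarrow> bool" where
  "open_L2 S = (\<forall>f\<in>S. \<forall>\<^sub>F (f', g) in uniformity. f' = f \<longrightarrow> g \<in> S)"

instance
proof
  fix f g h :: L2 and a :: real
  show "f \<bullet> g = g \<bullet> f"
    by transfer (simp add: inner_commute)
  show "(f + g) \<bullet> h = f \<bullet> h + g \<bullet> h"
    by transfer
      (auto simp: L2_rel_def inner_add_left integrable_inner_square_integrable)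
  show "(a *\<^sub>R f) \<bullet> g = a * (f \<bullet> g)"
    by transfer (simp add: inner_mult_left flip: scaleR_conv_of_real)
  show "0 \<le> f \<bullet> f"
    by transfer simp
  show "f \<bullet> f = 0 \<longleftrightarrow> f = 0"
  proof transfer
    fix f assume "L2_rel f f"
    then have f: "square_integrable f"
      by (simp add: L2_rel_def)
    then have "(LINT x|lborel. f x \<bullet> f x) = 0 \<longleftrightarrow> (AE x in lborel. f x \<bullet> f x = 0)"
      by (intro integral_nonneg_eq_0_iff_AE integrable_inner_square_integrable) auto
    with f show "(LINT x|lborel. f x \<bullet> f x) = 0 \<longleftrightarrow> L2_rel f (\<lambda>_. 0)"
      by (simp add: L2_rel_def square_integrable_zero)
  qed
qed (rule norm_L2_def dist_L2_def sgn_L2_def uniformity_L2_def open_L2_def)+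

end

text \<open>The complex space \<open>L\<^sup>2(0,L)\<close> is realised inside \<^typ>\<open>L2\<close>, that is \<open>L\<^sup>2(\<real>)\<close>, by extension by
  zero; the inclusion is isometric.  \<^const>\<open>rep_L2\<close> picks a representative.\<close>

definition L2_on :: "real \<Rightarrow> L2 set" where
  "L2_on L = {f. AE x in lborel. x \<notin> {0<..<L} \<longrightarrow> rep_L2 f x = 0}"

definition L2_mean_zero :: "real \<Rightarrow> L2 set" where
  "L2_mean_zero L = {f \<in> L2_on L. (LINT x:{0<..<L}|lborel. rep_L2 f x) = 0}"

section \<open>Sobolev spaces on the interval\<close>

text \<open>\<open>C\<^sub>c\<^sup>\<infinity>(0,L)\<close>, each function being extended by zero to the whole line.\<close>

definition test_function :: "real \<Rightarrow> (real \<Rightarrow> complex) \<Rightarrow> bool" where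
  "test_function L \<eta> \<longleftrightarrow>
     (\<exists>d :: nat \<Rightarrow> real \<Rightarrow> complex. d 0 = \<eta> \<and>
        (\<forall>n x. (d n has_vector_derivative d (Suc n) x) (at x))) \<and>
     (\<exists>K. compact K \<and> K \<subseteq> {0<..<L} \<and> (\<forall>x. x \<notin> K \<longrightarrow> \<eta> x = 0))"

definition is_weak_deriv :: "real \<Rightarrow> L2 \<Rightarrow> L2 \<Rightarrow> bool" where
  "is_weak_deriv L f g \<longleftrightarrow>
     (\<forall>\<eta>. test_function L \<eta> \<longrightarrow>
        (LINT x:{0<..<L}|lborel. rep_L2 f x * vector_derivative \<eta> (at x)) =
        - (LINT x:{0<..<L}|lborel. rep_L2 g x * \<eta> x))"

definition H1 :: "real \<Rightarrow> L2 set" where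
  "H1 L = {f \<in> L2_on L. \<exists>g \<in> L2_on L. is_weak_deriv L f g}"

text \<open>Only meaningful on \<^term>\<open>H1 L\<close>.\<close>

definition wderiv :: "real \<Rightarrow> L2 \<Rightarrow> L2" where
  "wderiv L f = (THE g. g \<in> L2_on L \<and> is_weak_deriv L f g)"

definition H2 :: "real \<Rightarrow> L2 set" where
  "H2 L = {f \<in> H1 L. wderiv L f \<in> H1 L}"

text \<open>\<open>H\<^sub>0\<^sup>1(0,L)\<close> is the closure of the test functions in the \<open>H\<^sup>1\<close>-norm, i.e. the graph norm of the
  weak derivative.\<close>

definition H1_0 :: "real \<Rightarrow> L2 set" where
  "H1_0 L = {f \<in> H1 L. (f, wderiv L f) \<in>
     closure {(abs_L2 \<eta>, abs_L2 (\<lambda>x. vector_derivative \<eta> (at x))) | \<eta>. test_function L \<eta>}}"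

definition H1_mean_zero :: "real \<Rightarrow> L2 set" where
  "H1_mean_zero L = H1 L \<inter> L2_mean_zero L"

section \<open>Semigroups of operators\<close>

text \<open>In this section \<open>X\<close> is a complex linear subspace of the ambient type and \<open>N\<close> a norm on \<open>X\<close>,
  which need not be the restriction of a norm of the ambient type.  Operators are only considered
  on \<open>X\<close>, semigroups only at times \<open>t \<ge> 0\<close>.\<close>

definition bounded_operator ::
  "'a::complex_vector set \<Rightarrow> ('a \<Rightarrow> real) \<Rightarrow> ('a \<Rightarrow> 'a) \<Rightarrow> bool" where
  "bounded_operator X N S \<longleftrightarrow>
     (\<forall>x\<in>X. S x \<in> X) \<and>
     (\<forall>x\<in>X. \<forall>y\<in>X. S (x + y) = S x + S y) \<and>
     (\<forall>c. \<forall>x\<in>X. S (c *\<^sub>C x) = c *\<^sub>C S x) \<and>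
     (\<exists>C. \<forall>x\<in>X. N (S x) \<le> C * N x)"

definition operator_norm ::
  "'a::complex_vector set \<Rightarrow> ('a \<Rightarrow> real) \<Rightarrow> ('a \<Rightarrow> 'a) \<Rightarrow> real" where
  "operator_norm X N S = (SUP x\<in>{x \<in> X. N x \<le> 1}. N (S x))"

definition C0_semigroup ::
  "'a::complex_vector set \<Rightarrow> ('a \<Rightarrow> real) \<Rightarrow> (real \<Rightarrow> 'a \<Rightarrow> 'a) \<Rightarrow> bool" where
  "C0_semigroup X N T \<longleftrightarrow>
     (\<forall>t\<ge>0. bounded_operator X N (T t)) \<and>
     (\<forall>x\<in>X. T 0 x = x) \<and>
     (\<forall>s\<ge>0. \<forall>t\<ge>0. \<forall>x\<in>X. T (s + t) x = T s (T t x)) \<and>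
     (\<forall>x\<in>X. ((\<lambda>t. N (T t x - x)) \<longlongrightarrow> 0) (at_right 0))"

text \<open>\<open>y\<close> is the right derivative of the orbit of \<open>x\<close> at time 0.\<close>

definition generator_rel ::
  "('a::complex_vector \<Rightarrow> real) \<Rightarrow> (real \<Rightarrow> 'a \<Rightarrow> 'a) \<Rightarrow> 'a \<Rightarrow> 'a \<Rightarrow> bool" where
  "generator_rel N T x y \<longleftrightarrow>
     ((\<lambda>t. N (inverse t *\<^sub>R (T t x - x) - y)) \<longlongrightarrow> 0) (at_right 0)"

text \<open>The operator \<open>A\<close> with domain \<open>D\<close> is the infinitesimal generator of \<open>T\<close>, including equality of
  the domains.\<close>

definition generates ::
  "'a::complex_vector set \<Rightarrow> ('a \<Rightarrow> real) \<Rightarrow> 'a set \<Rightarrow> ('a \<Rightarrow> 'a) \<Rightarrow> (real \<Rightarrow> 'a \<Rightarrow> 'a) \<Rightarrow> bool" where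
  "generates X N D A T \<longleftrightarrow>
     C0_semigroup X N T \<and>
     D = {x \<in> X. \<exists>y\<in>X. generator_rel N T x y} \<and>
     (\<forall>x\<in>D. A x \<in> X \<and> generator_rel N T x (A x))"

definition exponentially_stable ::
  "'a::complex_vector set \<Rightarrow> ('a \<Rightarrow> real) \<Rightarrow> (real \<Rightarrow> 'a \<Rightarrow> 'a) \<Rightarrow> bool" where
  "exponentially_stable X N T \<longleftrightarrow>
     (\<exists>M>0. \<exists>\<omega>>0. \<forall>t\<ge>0. operator_norm X N (T t) \<le> M * exp (- \<omega> * t))"

section \<open>The operator of the coupled system\<close>

text \<open>Components are \<open>(u, v, \<phi>, \<Phi>, \<psi>, \<Psi>, \<theta>, q)\<close>.\<close>

type_synonym state = "L2 \<times> L2 \<times> L2 \<times> L2 \<times> L2 \<times> L2 \<times> L2 \<times> L2"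

definition state_space :: "real \<Rightarrow> state set" where
  "state_space L =
     H1_mean_zero L \<times> L2_mean_zero L \<times> H1_mean_zero L \<times> L2_mean_zero L \<times>
     H1_0 L \<times> L2_on L \<times> L2_on L \<times> L2_on L"

definition energy_norm ::
  "real \<Rightarrow> real \<Rightarrow> real \<Rightarrow> real \<Rightarrow> real \<Rightarrow> real \<Rightarrow> real \<Rightarrow> real \<Rightarrow> real \<Rightarrow> real \<Rightarrow> state \<Rightarrow> real"
where
  "energy_norm L \<rho> \<rho>\<^sub>1 \<rho>\<^sub>2 \<rho>\<^sub>3 \<alpha> \<kappa> b \<tau> \<beta> = (\<lambda>(u, v, \<phi>, \<Phi>, \<psi>, \<Psi>, \<theta>, q).
     sqrt (\<rho> * (norm v)\<^sup>2 + \<alpha> * (norm (wderiv L u))\<^sup>2 + \<rho>\<^sub>1 * (norm \<Phi>)\<^sup>2 + \<rho>\<^sub>2 * (norm \<Psi>)\<^sup>2 +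
       b * (norm (wderiv L \<psi>))\<^sup>2 + \<beta> * (norm (\<phi> - u))\<^sup>2 + \<kappa> * (norm (wderiv L \<phi> + \<psi>))\<^sup>2 +
       \<rho>\<^sub>3 * (norm \<theta>)\<^sup>2 + \<tau> * (norm q)\<^sup>2))"

definition dom_A1 :: "real \<Rightarrow> state set" where
  "dom_A1 L = {(u, v, \<phi>, \<Phi>, \<psi>, \<Psi>, \<theta>, q).
     (u, v, \<phi>, \<Phi>, \<psi>, \<Psi>, \<theta>, q) \<in> state_space L \<and>
     v \<in> H1_mean_zero L \<and> \<Phi> \<in> H1_mean_zero L \<and>
     wderiv L u \<in> H1_0 L \<and> wderiv L \<phi> \<in> H1_0 L \<and> \<theta> \<in> H1_0 L \<and> \<Psi> \<in> H1_0 L \<and>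
     \<psi> \<in> H2 L \<and> q \<in> H1 L}"

definition A1 ::
  "real \<Rightarrow> real \<Rightarrow> real \<Rightarrow> real \<Rightarrow> real \<Rightarrow> real \<Rightarrow> real \<Rightarrow> real \<Rightarrow> real \<Rightarrow> real \<Rightarrow> real \<Rightarrow> real \<Rightarrow>
   real \<Rightarrow> state \<Rightarrow> state"
where
  "A1 L \<rho> \<rho>\<^sub>1 \<rho>\<^sub>2 \<rho>\<^sub>3 \<alpha> \<kappa> b \<tau> \<sigma> \<beta> \<gamma> m = (\<lambda>(u, v, \<phi>, \<Phi>, \<psi>, \<Psi>, \<theta>, q).
     (v,
      inverse \<rho> *\<^sub>R (\<alpha> *\<^sub>R wderiv L (wderiv L u) + \<beta> *\<^sub>R (\<phi> - u) - \<gamma> *\<^sub>R v),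
      \<Phi>,
      inverse \<rho>\<^sub>1 *\<^sub>R (\<kappa> *\<^sub>R wderiv L (wderiv L \<phi> + \<psi>) - \<beta> *\<^sub>R (\<phi> - u) - m *\<^sub>R wderiv L \<theta>),
      \<Psi>,
      inverse \<rho>\<^sub>2 *\<^sub>R (b *\<^sub>R wderiv L (wderiv L \<psi>) - \<kappa> *\<^sub>R (wderiv L \<phi> + \<psi>) + m *\<^sub>R \<theta>),
      inverse \<rho>\<^sub>3 *\<^sub>R (- wderiv L q - m *\<^sub>R (wderiv L \<Phi> + \<Psi>)),
      inverse \<tau> *\<^sub>R (- (\<sigma> *\<^sub>R q) - wderiv L \<theta>)))"

end

theory Submission
  imports Defs
begin

text \<open>
  An exponentially stable semigroup has a resolvent that is bounded along the imaginary axis, so it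
  is enough to find unit-size states that \<open>A1\<close> almost multiplies by a purely imaginary number
  (quasimodes), with an error that tends to zero. They exist because of high-frequency rotation
  waves. The boundary conditions are compatible with the separation of variables in which
  \<open>u, \<phi>, q\<close> are multiples of \<open>cos (k x)\<close> and \<open>\<psi>, \<theta>\<close> are multiples of \<open>sin (k x)\<close> with
  \<open>sin (k L) = 0\<close>, and on each such block \<open>A1\<close> is an \<open>8 \<times> 8\<close> matrix.

  Damping acts only through \<open>v\<close> and \<open>q\<close>. Consider a wave carried by \<open>\<psi>\<close> alone, with amplitude
  \<open>1 / k\<close> and with the frequency \<open>s k\<close>, \<open>s\<^sup>2 = b / \<rho>\<^sub>2\<close>, of the undamped rotation equation. Its
  coupling terms \<open>\<kappa> \<psi>\<^sub>x\<close> and \<open>m \<Psi>\<close> in the equations for \<open>\<Phi>\<close> and \<open>\<theta>\<close> are of order one, but can be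
  cancelled by corrections \<open>\<phi> = X / k\<^sup>2\<close>, \<open>\<theta> = Y / k\<close>, \<open>q = \<i> Y / (s \<tau> k)\<close> of lower order: \<open>X\<close> and
  \<open>Y\<close> must solve
  \<open>(\<rho>\<^sub>1 s\<^sup>2 - \<kappa>) X - m Y = - \<kappa>\<close> and \<open>m X - (\<rho>\<^sub>3 - 1 / (s\<^sup>2 \<tau>)) Y = m\<close>.
  The determinant of this system is \<open>\<chi>\<^sub>0 b / \<rho>\<^sub>2\<close>, which is where \<open>\<chi>\<^sub>0\<close> comes from. What remains is of
  order \<open>1 / k\<close> (lemma \<open>quasimode_residual\<close>), while \<open>\<Psi> = \<i> s sin (k x)\<close> keeps the energy bounded
  below. The alternative \<open>\<chi>\<^sub>0 = \<chi>\<^sub>1 = 0\<close> cannot occur for admissible constants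
  (\<open>chi_not_both_zero\<close>).

  The resolvent bound (\<open>exponentially_stable_imp_resolvent_bound\<close>) is obtained without integrating
  in time, by telescoping over small time steps. The rest of the work is functional analysis on
  \<open>(0,L)\<close>: weak derivatives are unique, by the fundamental lemma of the calculus of variations, and
  hence linear; they agree with classical ones; and smooth functions vanishing at both end points
  lie in \<open>H\<^sub>0\<^sup>1\<close>. These make the energy norm a seminorm on a complex vector space and
  put the trigonometric states into the domain of \<open>A1\<close>.
\<close>

section \<open>Exponential stability and approximate eigenvectors\<close>

definition complex_subspace :: "'a::complex_vector set \<Rightarrow> bool" where
  "complex_subspace X \<longleftrightarrow>
     0 \<in> X \<and> (\<forall>x\<in>X. \<forall>y\<in>X. x + y \<in> X) \<and> (\<forall>c. \<forall>x\<in>X. c *\<^sub>C x \<in> X)"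

lemma scaleC_one [simp]: "1 *\<^sub>C x = (x :: 'a::complex_vector)"
  using scaleR_scaleC[of 1 x] by simp

lemma scaleC_minus_one: "(-1) *\<^sub>C x = - (x :: 'a::complex_vector)"
  using scaleR_scaleC[of "-1" x] by simp

lemma scaleC_zero_left [simp]: "0 *\<^sub>C x = (0 :: 'a::complex_vector)"
  using scaleR_scaleC[of 0 x] by simp

lemma scaleC_minus_left: "(- c) *\<^sub>C x = - (c *\<^sub>C (x :: 'a::complex_vector))"
  using scaleC_add_left[of "- c" c x] by (simp add: eq_neg_iff_add_eq_0)

lemma scaleC_diff_right: "c *\<^sub>C (x - y) = c *\<^sub>C x - c *\<^sub>C (y :: 'a::complex_vector)"
  using scaleC_add_right[of c "x - y" y] by (simp add: eq_diff_eq)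

lemma scaleC_zero_right [simp]: "c *\<^sub>C (0 :: 'a::complex_vector) = 0"
  using scaleC_diff_right[of c 0 0] by simp

lemma complex_subspace_diff:
  assumes "complex_subspace X" "x \<in> X" "y \<in> X"
  shows "x - y \<in> X"
proof -
  have "x + (-1) *\<^sub>C y \<in> X"
    using assms unfolding complex_subspace_def by blast
  then show ?thesis by (simp add: scaleC_minus_one)
qed

lemma complex_subspace_scaleR:
  "complex_subspace X \<Longrightarrow> x \<in> X \<Longrightarrow> r *\<^sub>R x \<in> X"
  by (simp add: scaleR_scaleC complex_subspace_def)

text \<open>The energy norm does not come from the norm of the ambient type, so the semigroup argument is
  carried out for an arbitrary seminorm on an arbitrary subspace.\<close>

locale seminormed_subspace =
  fixes X :: "'a::complex_vector set" and N :: "'a \<Rightarrow> real"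
  assumes subspace: "complex_subspace X"
    and nonneg: "x \<in> X \<Longrightarrow> 0 \<le> N x"
    and triangle: "x \<in> X \<Longrightarrow> y \<in> X \<Longrightarrow> N (x + y) \<le> N x + N y"
    and homogeneous: "x \<in> X \<Longrightarrow> N (c *\<^sub>C x) = cmod c * N x"
begin

lemma mem_intros [simp, intro]:
  "x \<in> X \<Longrightarrow> y \<in> X \<Longrightarrow> x + y \<in> X"
  "x \<in> X \<Longrightarrow> y \<in> X \<Longrightarrow> x - y \<in> X"
  "x \<in> X \<Longrightarrow> c *\<^sub>C x \<in> X"
  "x \<in> X \<Longrightarrow> r *\<^sub>R x \<in> X"
  using subspace complex_subspace_diff[OF subspace] complex_subspace_scaleR[OF subspace]
  unfolding complex_subspace_def by blast+

lemma homogeneous_real: "x \<in> X \<Longrightarrow> N (r *\<^sub>R x) = \<bar>r\<bar> * N x"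
  by (simp add: scaleR_scaleC homogeneous)

text \<open>Normalising \<open>x\<close> requires \<open>N x \<noteq> 0\<close>. Where \<open>N x = 0\<close>,
  boundedness of the operator already gives \<open>N (S x) \<le> 0\<close>.\<close>

lemma operator_norm_bound:
  assumes "bounded_operator X N S" "x \<in> X"
  shows "N (S x) \<le> operator_norm X N S * N x"
proof -
  obtain C where C: "\<And>y. y \<in> X \<Longrightarrow> N (S y) \<le> C * N y"
    using assms(1) unfolding bounded_operator_def by blast
  have SX: "\<And>y. y \<in> X \<Longrightarrow> S y \<in> X"
    and Sscale: "\<And>c y. y \<in> X \<Longrightarrow> S (c *\<^sub>C y) = c *\<^sub>C S y"
    using assms(1) by (auto simp: bounded_operator_def)
  show ?thesis
  proof (cases "N x = 0")
    case True
    then show ?thesis using C[OF assms(2)] by simp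
  next
    case False
    then have pos: "N x > 0"
      using nonneg[OF assms(2)] by simp
    define y where "y = complex_of_real (inverse (N x)) *\<^sub>C x"
    have y: "y \<in> X" "N y = 1"
      using assms(2) pos by (auto simp: y_def homogeneous norm_inverse)
    have "N (S y) \<le> operator_norm X N S"
      unfolding operator_norm_def
    proof (rule cSUP_upper)
      show "y \<in> {x \<in> X. N x \<le> 1}" using y by simp
      show "bdd_above ((\<lambda>x. N (S x)) ` {x \<in> X. N x \<le> 1})"
      proof (rule bdd_aboveI2)
        fix z assume z: "z \<in> {x \<in> X. N x \<le> 1}"
        have "N (S z) \<le> C * N z" using z C by auto
        also have "\<dots> \<le> \<bar>C\<bar> * 1"
          using z nonneg[of z] by (intro mult_mono) auto
        finally show "N (S z) \<le> \<bar>C\<bar>" by simp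
      qed
    qed
    moreover have "N (S y) = N (S x) / N x"
      using pos assms(2) SX by (simp add: y_def Sscale homogeneous norm_inverse norm_divide field_simps)
    ultimately show ?thesis
      using pos by (simp add: field_simps)
  qed
qed

text \<open>If \<open>y\<close> is close to \<open>\<i> \<mu> x\<close>, the orbit of \<open>x\<close> stays
  close to \<open>exp (\<i> \<mu> t) x\<close>. For \<open>t = k h\<close> the difference \<open>T (k h) x -
  exp (\<i> \<mu> k h) x\<close> is a telescoping sum of \<open>k\<close> terms, each controlled by the error
  of one step of length \<open>h\<close>; letting \<open>h \<rightarrow> 0\<close>, the error of one step
  divided by \<open>h\<close> tends to the norm of \<open>y - \<i> \<mu> x\<close> because \<open>y\<close> is
  the right derivative at 0. In contrast to the variation of constants formula this uses neither integrals nor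
  orbits inside the domain.\<close>

lemma orbit_near_exponential:
  assumes sg: "C0_semigroup X N T"
    and bound: "\<And>s z. 0 \<le> s \<Longrightarrow> z \<in> X \<Longrightarrow> N (T s z) \<le> K * N z"
    and x: "x \<in> X" and y: "y \<in> X" and gen: "generator_rel N T x y"
    and t: "t > 0" and K: "K \<ge> 1"
  shows "N (T t x - cis (\<mu> * t) *\<^sub>C x) \<le> t * K * N (y - (\<i> * \<mu>) *\<^sub>C x)"
proof -
  have TX: "T s z \<in> X" if "s \<ge> 0" "z \<in> X" for s z
    using sg that by (auto simp: C0_semigroup_def bounded_operator_def)
  have Tadd: "T s (z + w) = T s z + T s w" if "s \<ge> 0" "z \<in> X" "w \<in> X" for s z w
    using sg that by (auto simp: C0_semigroup_def bounded_operator_def)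
  have Tscale: "T s (c *\<^sub>C z) = c *\<^sub>C T s z" if "s \<ge> 0" "z \<in> X" for s z c
    using sg that by (auto simp: C0_semigroup_def bounded_operator_def)
  have Tdiff: "T s (z - w) = T s z - T s w" if "s \<ge> 0" "z \<in> X" "w \<in> X" for s z w
    using Tadd[OF that(1), of "z - w" w] that by auto
  have telescope: "N (T (real k * h) x - cis (\<mu> * (real k * h)) *\<^sub>C x)
      \<le> real k * K * N (T h x - cis (\<mu> * h) *\<^sub>C x)" if "h > 0" for h k
  proof (induction k)
    case 0
    have "T 0 x = x" using sg x by (simp add: C0_semigroup_def)
    moreover have "N 0 = 0" using homogeneous[of x 0] x by simp
    ultimately show ?case by simp
  next
    case (Suc k)
    let ?d = "T h x - cis (\<mu> * h) *\<^sub>C x"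
    let ?e = "T (real k * h) x - cis (\<mu> * (real k * h)) *\<^sub>C x"
    have kh: "0 \<le> real k * h" "0 \<le> h" using that by auto
    have "T (real k * h + h) x = T (real k * h) (T h x)"
      using sg x kh by (auto simp: C0_semigroup_def)
    then have "T (real (Suc k) * h) x - cis (\<mu> * (real (Suc k) * h)) *\<^sub>C x
      = T (real k * h) ?d + cis (\<mu> * h) *\<^sub>C ?e"
      using x kh TX
      by (simp add: Tdiff Tscale scaleC_diff_right scaleC_scaleC cis_mult algebra_simps)
    also have "N \<dots> \<le> N (T (real k * h) ?d) + N (cis (\<mu> * h) *\<^sub>C ?e)"
      using x kh by (intro triangle mem_intros TX) auto
    also have "\<dots> \<le> K * N ?d + real k * K * N ?d"
      using bound[of "real k * h" ?d] x kh TX Suc.IH by (auto simp: homogeneous)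
    finally show ?case by (simp add: algebra_simps)
  qed
  \<comment> \<open>a bound for the error of one step of length \<open>h\<close>, divided by \<open>h\<close>: \<open>y\<close> replaces the difference quotient of the
    orbit, \<open>\<i> \<mu> x\<close> replaces \<open>y\<close>, and the difference quotient of the exponential replaces \<open>\<i> \<mu>\<close>\<close>
  let ?r = "\<lambda>h. N (inverse h *\<^sub>R (T h x - x) - y) + N (y - (\<i> * \<mu>) *\<^sub>C x)
      + cmod ((cis (\<mu> * h) - 1) / h - \<i> * \<mu>) * N x"
  have estimate: "N (T t x - cis (\<mu> * t) *\<^sub>C x) \<le> t * K * ?r (t / real (Suc k))" for k
  proof -
    define h where "h = t / real (Suc k)"
    have h: "h > 0" "real (Suc k) * h = t" using t by (auto simp: h_def)
    let ?A = "inverse h *\<^sub>R (T h x - x) - y" and ?B = "y - (\<i> * \<mu>) *\<^sub>C x"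
      and ?C = "((cis (\<mu> * h) - 1) / h - \<i> * \<mu>) *\<^sub>C x"
    have mem: "?A \<in> X" "?B \<in> X" "?C \<in> X" "T h x - cis (\<mu> * h) *\<^sub>C x \<in> X"
      using x y h TX by auto
    have "?C = inverse (complex_of_real h) *\<^sub>C (cis (\<mu> * h) *\<^sub>C x) - inverse (complex_of_real h) *\<^sub>C x
        - (\<i> * \<mu>) *\<^sub>C x"
    proof -
      have *: "a *\<^sub>C x - b *\<^sub>C x = (a - b) *\<^sub>C x" for a b
        using scaleC_add_left[of a "-b" x] by (simp add: scaleC_minus_left)
      show ?thesis
        by (simp add: scaleC_scaleC * diff_divide_distrib divide_inverse algebra_simps)
    qed
    then have "inverse h *\<^sub>R (T h x - cis (\<mu> * h) *\<^sub>C x) = ?A + ?B - ?C"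
      by (simp add: scaleR_scaleC scaleC_diff_right)
    then have "inverse h * N (T h x - cis (\<mu> * h) *\<^sub>C x) = N (?A + ?B + (-1) *\<^sub>C ?C)"
      using homogeneous_real[of "T h x - cis (\<mu> * h) *\<^sub>C x" "inverse h"] mem h
      by (simp add: scaleC_minus_one)
    also have "\<dots> \<le> N (?A + ?B) + N ((-1) *\<^sub>C ?C)"
      by (rule triangle[OF mem_intros(1)[OF mem(1,2)] mem_intros(3)[OF mem(3)]])
    also have "\<dots> \<le> N ?A + N ?B + N ((-1) *\<^sub>C ?C)"
      using mem triangle[of ?A ?B] by auto
    also have "N ((-1) *\<^sub>C ?C) = cmod ((cis (\<mu> * h) - 1) / h - \<i> * \<mu>) * N x"
      using mem x by (simp add: homogeneous)
    finally have "N (T h x - cis (\<mu> * h) *\<^sub>C x) \<le> h * ?r h"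
      using h by (simp add: field_simps)
    then have "real (Suc k) * K * N (T h x - cis (\<mu> * h) *\<^sub>C x) \<le> real (Suc k) * K * (h * ?r h)"
      using K by (intro mult_left_mono) auto
    also have "\<dots> = t * K * ?r h"
      by (simp only: h(2)[symmetric] ac_simps)
    finally show ?thesis
      using telescope[OF h(1), of "Suc k"] unfolding h(2) unfolding h_def by linarith
  qed
  have h_lim: "filterlim (\<lambda>k. t / real (Suc k)) (at_right 0) sequentially"
    unfolding filterlim_at
  proof
    show "(\<lambda>k. t / real (Suc k)) \<longlonglongrightarrow> 0"
      using tendsto_mult[OF tendsto_const[of t] LIMSEQ_inverse_real_of_nat]
      by (simp add: divide_inverse)
  qed (use t in auto)
  have r_lim: "(?r \<longlongrightarrow> 0 + N (y - (\<i> * \<mu>) *\<^sub>C x) + 0 * N x) (at_right 0)"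
  proof (intro tendsto_intros)
    show "((\<lambda>h. N (inverse h *\<^sub>R (T h x - x) - y)) \<longlongrightarrow> 0) (at_right 0)"
      using gen by (simp add: generator_rel_def)
    have "((\<lambda>z::complex. exp (\<i> * \<mu> * z)) has_field_derivative \<i> * \<mu>) (at 0)"
      by (auto intro!: derivative_eq_intros)
    then have "((\<lambda>z::complex. (exp (\<i> * \<mu> * z) - 1) / z) \<longlongrightarrow> \<i> * \<mu>) (at 0)"
      by (simp add: DERIV_def)
    moreover have "filterlim complex_of_real (at 0) (at_right 0)"
      unfolding filterlim_at
      using tendsto_of_real[OF tendsto_ident_at, of 0 "{0<..}", where ?'a = complex]
      by (auto simp: eventually_at_filter)
    ultimately have "((\<lambda>h. (exp (\<i> * \<mu> * complex_of_real h) - 1) / complex_of_real h) \<longlongrightarrow> \<i> * \<mu>)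
        (at_right 0)"
      by (rule filterlim_compose)
    then show "((\<lambda>h. cmod ((cis (\<mu> * h) - 1) / h - \<i> * \<mu>)) \<longlongrightarrow> 0) (at_right 0)"
      by (simp add: cis_conv_exp LIM_zero tendsto_norm_zero mult.assoc)
  qed
  have "(\<lambda>k. t * K * ?r (t / real (Suc k))) \<longlonglongrightarrow> t * K * N (y - (\<i> * \<mu>) *\<^sub>C x)"
    using tendsto_mult[OF tendsto_const[of "t * K"] filterlim_compose[OF r_lim h_lim]] by simp
  then show ?thesis
    by (rule LIMSEQ_le_const) (use estimate in auto)
qed

text \<open>At a time \<open>t\<close> when \<open>T t\<close> has norm at most \<open>1/2\<close>, the vector
  \<open>exp (\<i> \<mu> t) x\<close> has the same size as \<open>x\<close> while \<open>T t x\<close> is at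
  most half as large, so at least \<open>N x / 2\<close> has to be paid for by the error in
  \<open>orbit_near_exponential\<close>. The time does not depend on \<open>\<mu>\<close>.\<close>

lemma exponentially_stable_imp_resolvent_bound:
  assumes gen: "generates X N D A T" and stable: "exponentially_stable X N T"
  obtains C where "\<And>x \<mu>. x \<in> D \<Longrightarrow> N x \<le> C * N (A x - (\<i> * complex_of_real \<mu>) *\<^sub>C x)"
proof -
  have sg: "C0_semigroup X N T" using gen by (simp add: generates_def)
  obtain M \<omega> where M: "M > 0" "\<omega> > 0"
    and decay: "\<And>t. t \<ge> 0 \<Longrightarrow> operator_norm X N (T t) \<le> M * exp (- \<omega> * t)"
    using stable unfolding exponentially_stable_def by blast
  have TX: "T s z \<in> X" if "s \<ge> 0" "z \<in> X" for s z
    using sg that by (auto simp: C0_semigroup_def bounded_operator_def)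
  have bound: "N (T s z) \<le> M * exp (- \<omega> * s) * N z" if "0 \<le> s" "z \<in> X" for s z
  proof -
    have "N (T s z) \<le> operator_norm X N (T s) * N z"
      using sg that by (intro operator_norm_bound) (auto simp: C0_semigroup_def)
    also have "\<dots> \<le> M * exp (- \<omega> * s) * N z"
      using decay that nonneg by (intro mult_right_mono) auto
    finally show ?thesis .
  qed
  have bound_const: "N (T s z) \<le> max 1 M * N z" if "0 \<le> s" "z \<in> X" for s z
  proof -
    have "M * exp (- \<omega> * s) \<le> M * 1"
      using M that by (intro mult_left_mono) auto
    then have "M * exp (- \<omega> * s) * N z \<le> max 1 M * N z"
      using nonneg that by (intro mult_right_mono) auto
    then show ?thesis using bound[OF that] by linarith
  qed
  \<comment> \<open>\<open>max 1 M\<close> instead of \<open>M\<close> makes \<open>t\<close> positive\<close>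
  define t where "t = ln (max 1 M * 2) / \<omega>"
  have "max 1 M * 2 > 1" by (simp add: max_def)
  then have t: "t > 0" using M by (simp add: t_def)
  have "exp (\<omega> * t) = max 1 M * 2"
    using M by (simp add: t_def)
  then have "M * exp (- \<omega> * t) = M / (max 1 M * 2)"
    by (simp add: exp_minus inverse_eq_divide)
  also have "\<dots> \<le> max 1 M / (max 1 M * 2)"
    by (intro divide_right_mono) auto
  also have "\<dots> = 1 / 2"
    by (simp add: max_def)
  finally have half: "M * exp (- \<omega> * t) \<le> 1 / 2" .
  show ?thesis
  proof (rule that[of "2 * (t * max 1 M)"])
    fix x and \<mu> :: real assume "x \<in> D"
    then have x: "x \<in> X" "A x \<in> X" "generator_rel N T x (A x)"
      using gen by (auto simp: generates_def)
    let ?e = "cis (\<mu> * t)"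
    have "N x = N (T t x + (-1) *\<^sub>C (T t x - ?e *\<^sub>C x))"
      using homogeneous[of x ?e] x by (simp add: scaleC_minus_one)
    also have "\<dots> \<le> N (T t x) + N ((-1) *\<^sub>C (T t x - ?e *\<^sub>C x))"
      using x t TX by (intro triangle) auto
    also have "N ((-1) *\<^sub>C (T t x - ?e *\<^sub>C x)) = N (T t x - ?e *\<^sub>C x)"
      using x t TX by (subst homogeneous) auto
    also have "\<dots> \<le> t * max 1 M * N (A x - (\<i> * \<mu>) *\<^sub>C x)"
      using x t by (intro orbit_near_exponential[OF sg bound_const]) auto
    also have "N (T t x) \<le> 1 / 2 * N x"
      using order_trans[OF bound[of t x] mult_right_mono[OF half]] x t nonneg by auto
    finally show "N x \<le> 2 * (t * max 1 M) * N (A x - (\<i> * \<mu>) *\<^sub>C x)" by simp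
  qed
qed

end

section \<open>Representatives of square-integrable classes\<close>

lemma square_integrable_rep [simp, intro]: "square_integrable (rep_L2 f)"
  using Quotient_rep_reflp[OF Quotient_L2, of f] by (simp add: L2_rel_def)

lemma measurable_rep_L2 [measurable]: "rep_L2 f \<in> borel_measurable borel"
  using square_integrable_measurable[OF square_integrable_rep] by simp

lemma abs_rep_L2 [simp]: "abs_L2 (rep_L2 f) = f"
  by (rule Quotient_abs_rep[OF Quotient_L2])

lemma L2_rel_self [simp]: "L2_rel f f \<longleftrightarrow> square_integrable f"
  by (simp add: L2_rel_def)

lemma AE_rep_abs:
  assumes "square_integrable f"
  shows "AE x in lborel. rep_L2 (abs_L2 f) x = f x"
proof -
  have "L2_rel (rep_L2 (abs_L2 f)) f"
    using assms by (intro Quotient_rep_abs[OF Quotient_L2]) simp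
  then show ?thesis by (simp add: L2_rel_def)
qed

lemma abs_L2_eqI:
  assumes "square_integrable f" "square_integrable g" "AE x in lborel. f x = g x"
  shows "abs_L2 f = abs_L2 g"
  using assms by (intro Quotient_rel_abs[OF Quotient_L2]) (simp add: L2_rel_def)

lemma abs_L2_add:
  "square_integrable f \<Longrightarrow> square_integrable g \<Longrightarrow> abs_L2 f + abs_L2 g = abs_L2 (\<lambda>x. f x + g x)"
  by (rule plus_L2.abs_eq) auto

lemma abs_L2_diff:
  "square_integrable f \<Longrightarrow> square_integrable g \<Longrightarrow> abs_L2 f - abs_L2 g = abs_L2 (\<lambda>x. f x - g x)"
  by (rule minus_L2.abs_eq) auto

lemma abs_L2_scaleC: "square_integrable f \<Longrightarrow> c *\<^sub>C abs_L2 f = abs_L2 (\<lambda>x. c * f x)"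
  by (rule scaleC_L2.abs_eq) auto

lemma AE_rep_zero: "AE x in lborel. rep_L2 0 x = 0"
  unfolding zero_L2_def by (intro AE_rep_abs square_integrable_zero)

lemma AE_rep_add: "AE x in lborel. rep_L2 (f + g) x = rep_L2 f x + rep_L2 g x"
  using AE_rep_abs[OF square_integrable_add[of "rep_L2 f" "rep_L2 g"]]
  by (simp flip: abs_L2_add)

lemma AE_rep_scaleC: "AE x in lborel. rep_L2 (c *\<^sub>C f) x = c * rep_L2 f x"
  using AE_rep_abs[OF square_integrable_scale[of "rep_L2 f" c]]
  by (simp flip: abs_L2_scaleC)

lemma norm_abs_L2:
  assumes "square_integrable f"
  shows "(norm (abs_L2 f))\<^sup>2 = (LINT x|lborel. (cmod (f x))\<^sup>2)"
proof -
  have "abs_L2 f \<bullet> abs_L2 f = (LINT x|lborel. f x \<bullet> f x)"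
    using assms by (intro inner_L2.abs_eq) auto
  then show ?thesis by (simp add: power2_norm_eq_inner)
qed

lemma norm_scaleC_L2: "norm (c *\<^sub>C (f :: L2)) = cmod c * norm f"
proof -
  have "(norm (c *\<^sub>C abs_L2 (rep_L2 f)))\<^sup>2 = (cmod c)\<^sup>2 * (norm (abs_L2 (rep_L2 f)))\<^sup>2"
    by (subst abs_L2_scaleC)
      (simp_all add: norm_abs_L2 square_integrable_scale norm_mult power_mult_distrib
        del: abs_rep_L2)
  then have "(norm (c *\<^sub>C f))\<^sup>2 = (cmod c * norm f)\<^sup>2"
    by (simp add: power_mult_distrib)
  then show ?thesis
    by (rule power2_eq_imp_eq) auto
qed

lemma integrable_mult_square_integrable:
  assumes "square_integrable f" "square_integrable g"
  shows "integrable lborel (\<lambda>x. f x * g x)"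
proof -
  have [measurable]: "f \<in> borel_measurable lborel" "g \<in> borel_measurable lborel"
    using assms by (auto simp: square_integrable_def)
  have *: "cmod (a * b) \<le> (cmod a)\<^sup>2 + (cmod b)\<^sup>2" for a b
    using sum_squares_bound[of "cmod a" "cmod b"] mult_nonneg_nonneg[of "cmod a" "cmod b"]
    by (simp add: norm_mult del: mult_nonneg_nonneg)
  have "integrable lborel (\<lambda>x. (cmod (f x))\<^sup>2 + (cmod (g x))\<^sup>2)"
    using assms by (auto simp: square_integrable_def)
  then show ?thesis
    by (rule Bochner_Integration.integrable_bound) (auto intro: *)
qed

lemma square_integrable_restrict:
  fixes f :: "real \<Rightarrow> complex"
  assumes "continuous_on UNIV f"
  shows "square_integrable (\<lambda>x. indicator {0<..<L} x * f x)"
proof -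
  have [measurable]: "f \<in> borel_measurable borel"
    using assms by (rule borel_measurable_continuous_onI)
  have "integrable lborel (\<lambda>x. indicator {0..L} x *\<^sub>R (cmod (f x))\<^sup>2)"
    by (intro borel_integrable_compact continuous_intros continuous_on_subset[OF assms]) auto
  then have "integrable lborel (\<lambda>x. (cmod (indicator {0<..<L} x * f x))\<^sup>2)"
    by (rule Bochner_Integration.integrable_bound) (auto simp: indicator_def)
  then show ?thesis by (simp add: square_integrable_def)
qed

text \<open>The factor \<open>h\<close> in the next lemmas will be a test function or its derivative, or 1 for the
  mean value. Taking \<open>h\<close> continuous on the whole line covers all of these.\<close>

lemma set_integrable_rep_mult:
  assumes "continuous_on UNIV h"
  shows "set_integrable lborel {0<..<L} (\<lambda>x. rep_L2 f x * h x)"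
proof -
  have "integrable lborel (\<lambda>x. rep_L2 f x * (indicator {0<..<L} x * h x))"
    by (intro integrable_mult_square_integrable square_integrable_restrict assms) auto
  then show ?thesis
    by (simp add: set_integrable_def scaleR_conv_of_real of_real_indicator mult.left_commute)
qed

lemma set_integral_rep_mult_add:
  assumes "continuous_on UNIV h"
  shows "(LINT x:{0<..<L}|lborel. rep_L2 (f + g) x * h x)
    = (LINT x:{0<..<L}|lborel. rep_L2 f x * h x) + (LINT x:{0<..<L}|lborel. rep_L2 g x * h x)"
proof -
  have [measurable]: "h \<in> borel_measurable borel"
    using assms by (rule borel_measurable_continuous_onI)
  have "(LINT x:{0<..<L}|lborel. rep_L2 (f + g) x * h x)
    = (LINT x:{0<..<L}|lborel. rep_L2 f x * h x + rep_L2 g x * h x)"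
    using AE_rep_add[of f g]
    by (intro set_lebesgue_integral_cong_AE) (auto elim!: eventually_mono simp: distrib_right)
  then show ?thesis
    using set_integral_add(2)[OF set_integrable_rep_mult set_integrable_rep_mult] assms by simp
qed

lemma set_integral_rep_mult_scaleC:
  assumes "continuous_on UNIV h"
  shows "(LINT x:{0<..<L}|lborel. rep_L2 (c *\<^sub>C f) x * h x)
    = c * (LINT x:{0<..<L}|lborel. rep_L2 f x * h x)"
proof -
  have [measurable]: "h \<in> borel_measurable borel"
    using assms by (rule borel_measurable_continuous_onI)
  have "(LINT x:{0<..<L}|lborel. rep_L2 (c *\<^sub>C f) x * h x)
    = (LINT x:{0<..<L}|lborel. c * (rep_L2 f x * h x))"
    using AE_rep_scaleC[of c f]
    by (intro set_lebesgue_integral_cong_AE) (auto elim!: eventually_mono simp: mult.assoc)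
  then show ?thesis by simp
qed

lemma set_integral_rep_abs:
  assumes "square_integrable f" "continuous_on UNIV h"
  shows "(LINT x:{0<..<L}|lborel. rep_L2 (abs_L2 f) x * h x)
    = (LINT x:{0<..<L}|lborel. f x * h x)"
proof -
  have [measurable]: "h \<in> borel_measurable borel"
    using assms by (auto intro: borel_measurable_continuous_onI simp: square_integrable_def)
  have [measurable]: "f \<in> borel_measurable borel"
    using assms by (simp add: square_integrable_def)
  show ?thesis
    using AE_rep_abs[OF assms(1)]
    by (intro set_lebesgue_integral_cong_AE) (auto elim!: eventually_mono)
qed

lemma set_integral_rep_zero: "(LINT x:{0<..<L}|lborel. rep_L2 0 x * h x) = 0"
proof -
  have "AE x in lborel. indicator {0<..<L} x *\<^sub>R (rep_L2 0 x * h x) = 0"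
    using AE_rep_zero by eventually_elim simp
  then show ?thesis
    unfolding set_lebesgue_integral_def by (rule integral_eq_zero_AE)
qed

lemma complex_subspace_L2_on: "complex_subspace (L2_on L)"
  unfolding complex_subspace_def
proof (intro conjI ballI allI)
  show "0 \<in> L2_on L"
    using AE_rep_zero by (auto simp: L2_on_def elim!: eventually_mono)
next
  fix f g assume "f \<in> L2_on L" "g \<in> L2_on L"
  then have "AE x in lborel. x \<notin> {0<..<L} \<longrightarrow> rep_L2 f x = 0"
    "AE x in lborel. x \<notin> {0<..<L} \<longrightarrow> rep_L2 g x = 0"
    unfolding L2_on_def by blast+
  with AE_rep_add[of f g] have "AE x in lborel. x \<notin> {0<..<L} \<longrightarrow> rep_L2 (f + g) x = 0"
    by eventually_elim simp
  then show "f + g \<in> L2_on L" by (simp add: L2_on_def)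
next
  fix c f assume "f \<in> L2_on L"
  then have "AE x in lborel. x \<notin> {0<..<L} \<longrightarrow> rep_L2 f x = 0"
    unfolding L2_on_def by blast
  with AE_rep_scaleC[of c f] have "AE x in lborel. x \<notin> {0<..<L} \<longrightarrow> rep_L2 (c *\<^sub>C f) x = 0"
    by eventually_elim simp
  then show "c *\<^sub>C f \<in> L2_on L" by (simp add: L2_on_def)
qed

lemma complex_subspace_L2_mean_zero: "complex_subspace (L2_mean_zero L)"
  using complex_subspace_L2_on[of L] set_integral_rep_zero[of L "\<lambda>_. 1"]
    set_integral_rep_mult_add[of "\<lambda>_. 1" L] set_integral_rep_mult_scaleC[of "\<lambda>_. 1" L]
  by (auto simp: complex_subspace_def L2_mean_zero_def)

definition L2_restrict :: "real \<Rightarrow> (real \<Rightarrow> complex) \<Rightarrow> L2" where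
  "L2_restrict L f = abs_L2 (\<lambda>x. indicator {0<..<L} x * f x)"

lemma L2_restrict_in_L2_on:
  "continuous_on UNIV f \<Longrightarrow> L2_restrict L f \<in> L2_on L"
  using AE_rep_abs[OF square_integrable_restrict[of f L]]
  by (auto simp: L2_on_def L2_restrict_def elim!: eventually_mono)

lemma scaleC_L2_restrict:
  assumes "continuous_on UNIV f"
  shows "c *\<^sub>C L2_restrict L f = L2_restrict L (\<lambda>x. c * f x)"
proof -
  have "(\<lambda>x. c * (indicator {0<..<L} x * f x)) = (\<lambda>x. indicator {0<..<L} x * (c * f x))"
    by (simp add: fun_eq_iff)
  then show ?thesis
    using abs_L2_scaleC[OF square_integrable_restrict[OF assms], of c L]
    by (simp add: L2_restrict_def del: mult.left_commute)
qed

lemma set_integral_L2_restrict: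
  assumes "continuous_on UNIV f" "continuous_on UNIV h"
  shows "(LINT x:{0<..<L}|lborel. rep_L2 (L2_restrict L f) x * h x)
    = (LINT x:{0<..<L}|lborel. f x * h x)"
proof -
  have "(LINT x:{0<..<L}|lborel. rep_L2 (L2_restrict L f) x * h x)
    = (LINT x:{0<..<L}|lborel. indicator {0<..<L} x * f x * h x)"
    unfolding L2_restrict_def
    by (rule set_integral_rep_abs[OF square_integrable_restrict]) (use assms in auto)
  also have "\<dots> = (LINT x:{0<..<L}|lborel. f x * h x)"
    by (intro set_lebesgue_integral_cong) auto
  finally show ?thesis .
qed

lemma norm_L2_restrict:
  assumes "continuous_on UNIV f"
  shows "(norm (L2_restrict L f))\<^sup>2 = (LINT x:{0<..<L}|lborel. (cmod (f x))\<^sup>2)"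
  unfolding L2_restrict_def norm_abs_L2[OF square_integrable_restrict[OF assms]]
    set_lebesgue_integral_def
  by (intro Bochner_Integration.integral_cong) (auto simp: indicator_def)

text \<open>Dominated convergence; the bound need only be uniform on the interval, which has finite
  measure.\<close>

lemma L2_restrict_tendsto:
  assumes "\<And>j. continuous_on UNIV (f j)" "continuous_on UNIV g"
    and "\<And>x. x \<in> {0<..<L} \<Longrightarrow> (\<lambda>j. f j x) \<longlonglongrightarrow> g x"
    and "\<And>j x. x \<in> {0<..<L} \<Longrightarrow> cmod (f j x) \<le> B"
  shows "(\<lambda>j. L2_restrict L (f j)) \<longlonglongrightarrow> L2_restrict L g"
proof -
  have [measurable]: "f j \<in> borel_measurable borel" "g \<in> borel_measurable borel" for j
    using assms(1,2) by (auto intro: borel_measurable_continuous_onI)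
  have gB: "cmod (g x) \<le> B" if "x \<in> {0<..<L}" for x
    using LIMSEQ_le_const2[OF tendsto_norm[OF assms(3)[OF that]]] assms(4)[OF that] by blast
  have diff: "L2_restrict L (f j) - L2_restrict L g = L2_restrict L (\<lambda>x. f j x - g x)" for j
    unfolding L2_restrict_def using assms(1,2)
    by (subst abs_L2_diff) (auto intro!: square_integrable_restrict simp: right_diff_distrib)
  have "(\<lambda>j. LINT x|lborel. indicator {0<..<L} x *\<^sub>R (cmod (f j x - g x))\<^sup>2)
    \<longlonglongrightarrow> (LINT x::real|lborel. (0::real))"
  proof (rule Bochner_Integration.integral_dominated_convergence
      [where w = "\<lambda>x. indicator {0<..<L} x *\<^sub>R (2 * B)\<^sup>2"])
    show "integrable lborel (\<lambda>x. indicator {0<..<L} x *\<^sub>R (2 * B)\<^sup>2)"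
      by (intro integrable_scaleR_left integrable_real_indicator emeasure_bounded_finite) auto
    show "AE x in lborel. (\<lambda>j. indicator {0<..<L} x *\<^sub>R (cmod (f j x - g x))\<^sup>2) \<longlonglongrightarrow> 0"
    proof (rule AE_I2)
      fix x :: real
      have "(\<lambda>j. (cmod (f j x - g x))\<^sup>2) \<longlonglongrightarrow> 0\<^sup>2" if "x \<in> {0<..<L}"
        using assms(3)[OF that] by (intro tendsto_power tendsto_norm_zero LIM_zero)
      then show "(\<lambda>j. indicator {0<..<L} x *\<^sub>R (cmod (f j x - g x))\<^sup>2) \<longlonglongrightarrow> 0"
        by (cases "x \<in> {0<..<L}") auto
    qed
    show "AE x in lborel. norm (indicator {0<..<L} x *\<^sub>R (cmod (f j x - g x))\<^sup>2)
        \<le> indicator {0<..<L} x *\<^sub>R (2 * B)\<^sup>2" for j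
    proof (rule AE_I2)
      fix x :: real
      have "(cmod (f j x - g x))\<^sup>2 \<le> (2 * B)\<^sup>2" if "x \<in> {0<..<L}"
      proof (rule power_mono)
        show "cmod (f j x - g x) \<le> 2 * B"
          using norm_triangle_ineq4[of "f j x" "g x"] assms(4)[OF that, of j] gB[OF that]
          by linarith
      qed simp
      then show "norm (indicator {0<..<L} x *\<^sub>R (cmod (f j x - g x))\<^sup>2)
        \<le> indicator {0<..<L} x *\<^sub>R (2 * B)\<^sup>2"
        by (cases "x \<in> {0<..<L}") auto
    qed
  qed auto
  then have "(\<lambda>j. (norm (L2_restrict L (f j) - L2_restrict L g))\<^sup>2) \<longlonglongrightarrow> 0"
    using assms(1,2) unfolding diff
    by (subst norm_L2_restrict) (auto intro!: continuous_intros simp: set_lebesgue_integral_def)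
  then have "(\<lambda>j. norm (L2_restrict L (f j) - L2_restrict L g)) \<longlonglongrightarrow> 0"
    using tendsto_real_sqrt by fastforce
  then show ?thesis
    using LIM_zero_iff tendsto_norm_zero_iff by blast
qed

section \<open>Smooth functions and cut-offs\<close>

text \<open>This is the first half of \<open>test_function\<close>. Derivatives of all orders are given by one
  sequence, so that no iterated derivative operator is needed.\<close>

definition smooth :: "(real \<Rightarrow> complex) \<Rightarrow> bool" where
  "smooth f \<longleftrightarrow> (\<exists>d :: nat \<Rightarrow> real \<Rightarrow> complex. d 0 = f \<and>
     (\<forall>n x. (d n has_vector_derivative d (Suc n) x) (at x)))"

text \<open>Membership in any class of functions that is closed under differentiation implies smoothness. All
  closure properties below are proved by exhibiting such a class.\<close>

lemma smooth_coinduct: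
  assumes "f \<in> S"
    and "\<And>f. f \<in> S \<Longrightarrow> \<exists>f'\<in>S. \<forall>x. (f has_vector_derivative f' x) (at x)"
  shows "smooth f"
proof -
  obtain D where D: "\<And>f. f \<in> S \<Longrightarrow> D f \<in> S"
    "\<And>f x. f \<in> S \<Longrightarrow> (f has_vector_derivative D f x) (at x)"
    using assms(2) by metis
  have "(D ^^ n) f \<in> S" for n
    by (induction n) (auto intro: D assms(1))
  then have "\<forall>n x. ((D ^^ n) f has_vector_derivative (D ^^ Suc n) f x) (at x)"
    by (auto intro: D)
  then show ?thesis
    unfolding smooth_def by (intro exI[of _ "\<lambda>n. (D ^^ n) f"]) auto
qed

lemma smooth_deriv:
  assumes "smooth f"
  obtains f' where "smooth f'" "\<And>x. (f has_vector_derivative f' x) (at x)"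
proof -
  obtain d where "d 0 = f" "\<And>n x. (d n has_vector_derivative d (Suc n) x) (at x)"
    using assms by (auto simp: smooth_def)
  moreover from this have "smooth (d 1)"
    unfolding smooth_def by (intro exI[of _ "\<lambda>n. d (Suc n)"]) auto
  ultimately show ?thesis
    using that[of "d 1"] by (metis One_nat_def)
qed

lemma smooth_continuous: "smooth f \<Longrightarrow> continuous_on S f"
  by (metis smooth_deriv continuous_at_imp_continuous_on has_vector_derivative_continuous)

lemma smooth_add: "smooth f \<Longrightarrow> smooth g \<Longrightarrow> smooth (\<lambda>x. f x + g x)"
proof (rule smooth_coinduct[where S = "{\<lambda>x. f x + g x | f g. smooth f \<and> smooth g}"])
  fix h assume "h \<in> {\<lambda>x. f x + g x | f g. smooth f \<and> smooth g}"
  then obtain f g where h: "h = (\<lambda>x. f x + g x)" "smooth f" "smooth g" by blast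
  obtain f' g' where "smooth f'" "\<And>x. (f has_vector_derivative f' x) (at x)"
    "smooth g'" "\<And>x. (g has_vector_derivative g' x) (at x)"
    using h smooth_deriv by metis
  then show "\<exists>h'\<in>{\<lambda>x. f x + g x | f g. smooth f \<and> smooth g}. \<forall>x. (h has_vector_derivative h' x) (at x)"
    unfolding h by (intro bexI[of _ "\<lambda>x. f' x + g' x"]) (auto intro!: derivative_intros)
qed blast

lemma smooth_affine: "smooth f \<Longrightarrow> smooth (\<lambda>x. r * f (a * x + b))" for a b :: real
proof (rule smooth_coinduct[where S = "{\<lambda>x. r * f (a * x + b) | f r. smooth f}"])
  fix h assume "h \<in> {\<lambda>x. r * f (a * x + b) | f r. smooth f}"
  then obtain f r where h: "h = (\<lambda>x. r * f (a * x + b))" "smooth f" by blast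
  obtain f' where f': "smooth f'" "\<And>x. (f has_vector_derivative f' x) (at x)"
    using h smooth_deriv by metis
  have "(h has_vector_derivative (r * a) * f' (a * x + b)) (at x)" for x
  proof -
    have "((\<lambda>x. a * x + b) has_real_derivative a) (at x)"
      by (auto intro!: derivative_eq_intros)
    then have "((f \<circ> (\<lambda>x. a * x + b)) has_vector_derivative a *\<^sub>R f' (a * x + b)) (at x)"
      by (intro vector_diff_chain_at f') (simp add: has_real_derivative_iff_has_vector_derivative)
    from has_vector_derivative_mult_right[OF this, of r] show ?thesis
      by (simp add: h o_def scaleR_conv_of_real mult.assoc)
  qed
  then show "\<exists>h'\<in>{\<lambda>x. r * f (a * x + b) | f r. smooth f}. \<forall>x. (h has_vector_derivative h' x) (at x)"
    using f' by (intro bexI[of _ "\<lambda>x. (r * a) * f' (a * x + b)"]) blast+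
qed blast

text \<open>By the Leibniz rule the derivative of a product of smooth functions is not a product but a sum of
  products, so the class closed under differentiation has to contain sums.\<close>

inductive sum_of_products :: "(real \<Rightarrow> complex) \<Rightarrow> bool" where
  product: "smooth f \<Longrightarrow> smooth g \<Longrightarrow> sum_of_products (\<lambda>x. f x * g x)"
| add: "sum_of_products f \<Longrightarrow> sum_of_products g \<Longrightarrow> sum_of_products (\<lambda>x. f x + g x)"

lemma smooth_mult:
  assumes "smooth f" "smooth g"
  shows "smooth (\<lambda>x. f x * g x)"
proof (rule smooth_coinduct[where S = "Collect sum_of_products"])
  show "(\<lambda>x. f x * g x) \<in> Collect sum_of_products"
    using assms by (auto intro: sum_of_products.intros)
  fix h assume "h \<in> Collect sum_of_products"
  then have "sum_of_products h" by simp
  then have "\<exists>h'. sum_of_products h' \<and> (\<forall>x. (h has_vector_derivative h' x) (at x))"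
  proof induction
    case (product f g)
    obtain f' g' where "smooth f'" "\<And>x. (f has_vector_derivative f' x) (at x)"
      "smooth g'" "\<And>x. (g has_vector_derivative g' x) (at x)"
      using product smooth_deriv by metis
    then show ?case
      using product
      by (intro exI[of _ "\<lambda>x. f x * g' x + f' x * g x"])
        (auto intro!: sum_of_products.intros has_vector_derivative_mult)
  next
    case (add f g)
    then obtain f' g' where "sum_of_products f'" "sum_of_products g'"
      "\<And>x. (f has_vector_derivative f' x) (at x)" "\<And>x. (g has_vector_derivative g' x) (at x)"
      by blast
    then show ?case
      by (intro exI[of _ "\<lambda>x. f' x + g' x"])
        (auto intro!: sum_of_products.intros derivative_intros)
  qed
  then show "\<exists>h'\<in>Collect sum_of_products. \<forall>x. (h has_vector_derivative h' x) (at x)"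
    by blast
qed

lemma smooth_trig:
  fixes k :: real
  shows "smooth (\<lambda>x. complex_of_real (p * cos (k * x) + q * sin (k * x)))"
proof (rule smooth_coinduct[where S = "{\<lambda>x. complex_of_real (p * cos (k * x) + q * sin (k * x)) | p q. True}"])
  fix h assume "h \<in> {\<lambda>x. complex_of_real (p * cos (k * x) + q * sin (k * x)) | p q. True}"
  then obtain p q where h: "h = (\<lambda>x. complex_of_real (p * cos (k * x) + q * sin (k * x)))" by blast
  have "(h has_vector_derivative complex_of_real ((k * q) * cos (k * x) + (- k * p) * sin (k * x))) (at x)" for x
    unfolding h
    by (intro has_vector_derivative_of_real)
      (auto intro!: derivative_eq_intros simp: has_real_derivative_iff_has_vector_derivative[symmetric])
  then show "\<exists>h'\<in>{\<lambda>x. complex_of_real (p * cos (k * x) + q * sin (k * x)) | p q. True}. \<forall>x. (h has_vector_derivative h' x) (at x)"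
    by (intro bexI[of _ "\<lambda>x. complex_of_real ((k * q) * cos (k * x) + (- k * p) * sin (k * x))"]) blast+
qed blast

text \<open>The case \<open>k = 0\<close> is the standard smooth function that is flat at the origin. The
  factors \<open>inverse x ^ k\<close> arise when it is differentiated.\<close>

definition flat :: "nat \<Rightarrow> real \<Rightarrow> real \<Rightarrow> real" where
  "flat k c x = (if x > 0 then inverse x ^ k * exp (- c * inverse x) else 0)"

text \<open>After the substitution \<open>y = 1 / x\<close> this says that the exponential beats every
  power.\<close>

lemma flat_tendsto_0:
  assumes "c > 0"
  shows "(flat k c \<longlongrightarrow> 0) (at 0)"
proof (rule filterlim_split_at)
  have "((\<lambda>y. y ^ k / exp (c * y)) \<longlongrightarrow> 0) at_top"
  proof -
    have "filterlim (\<lambda>y. c * y) at_top at_top"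
      using assms by (intro filterlim_tendsto_pos_mult_at_top[OF tendsto_const]) (auto simp: filterlim_ident)
    from filterlim_compose[OF tendsto_power_div_exp_0 this]
    have "((\<lambda>y. (1 / c ^ k) * ((c * y) ^ k / exp (c * y))) \<longlongrightarrow> (1 / c ^ k) * 0) at_top"
      by (intro tendsto_intros)
    then show ?thesis
      using assms by (simp add: power_mult_distrib)
  qed
  from filterlim_compose[OF this filterlim_inverse_at_top_right]
  have "((\<lambda>x. inverse x ^ k * exp (- c * inverse x)) \<longlongrightarrow> 0) (at_right 0)"
    by (simp add: exp_minus divide_inverse)
  then show "(flat k c \<longlongrightarrow> 0) (at_right 0)"
    by (rule Lim_transform_eventually) (auto simp: eventually_at_filter flat_def)
  show "(flat k c \<longlongrightarrow> 0) (at_left 0)"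
    by (rule tendsto_eventually) (auto simp: eventually_at_filter flat_def)
qed

text \<open>Away from the origin this is the product rule. At the origin the difference quotient of
  \<open>flat k\<close> is \<open>flat (k + 1)\<close>, which tends to 0.\<close>

lemma flat_deriv:
  assumes "c > 0"
  shows "(flat k c has_real_derivative c * flat (k + 2) c x - real k * flat (k + 1) c x) (at x)"
proof -
  consider "x > 0" | "x = 0" | "x < 0" by linarith
  then show ?thesis
  proof cases
    case 1
    have "((\<lambda>x. inverse x ^ k * exp (- c * inverse x)) has_real_derivative
        c * flat (k + 2) c x - real k * flat (k + 1) c x) (at x)"
      using 1 by (auto intro!: derivative_eq_intros simp: flat_def)
        (cases k; simp add: field_simps)
    then show ?thesis
      by (rule DERIV_cong_ev[OF refl _ refl, THEN iffD1, rotated])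
        (use 1 in \<open>auto simp: flat_def intro!: eventually_nhds[THEN iffD2, OF exI[of _ "{0<..}"]]\<close>)
  next
    case 2
    have "(flat k c (0 + h) - flat k c 0) / h = flat (k + 1) c h" for h
      by (simp add: flat_def field_simps)
    then have "(flat k c has_real_derivative 0) (at 0)"
      unfolding DERIV_def using flat_tendsto_0[OF assms, of "k + 1"] by simp
    then show ?thesis by (simp add: 2 flat_def)
  next
    case 3
    have "((\<lambda>x. 0) has_real_derivative 0) (at x)" by simp
    then have "(flat k c has_real_derivative 0) (at x)"
      by (rule DERIV_cong_ev[OF refl _ refl, THEN iffD1, rotated])
        (use 3 in \<open>auto simp: flat_def intro!: eventually_nhds[THEN iffD2, OF exI[of _ "{..<0}"]]\<close>)
    then show ?thesis using 3 by (simp add: flat_def)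
  qed
qed

text \<open>The linear span of the functions \<open>flat k c\<close>, closed under differentiation by
  \<open>flat_deriv\<close>.\<close>

inductive flat_sum :: "real \<Rightarrow> (real \<Rightarrow> real) \<Rightarrow> bool" for c where
  flat: "flat_sum c (\<lambda>x. a * flat k c x)"
| add: "flat_sum c f \<Longrightarrow> flat_sum c g \<Longrightarrow> flat_sum c (\<lambda>x. f x + g x)"

lemma smooth_flat:
  assumes "c > 0"
  shows "smooth (\<lambda>x. complex_of_real (flat k c x))"
proof (rule smooth_coinduct[where S = "{\<lambda>x. complex_of_real (f x) | f. flat_sum c f}"])
  have "flat_sum c (flat k c)"
    using flat_sum.flat[of c 1 k] by simp
  then show "(\<lambda>x. complex_of_real (flat k c x)) \<in> {\<lambda>x. complex_of_real (f x) | f. flat_sum c f}"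
    by blast
  fix h assume "h \<in> {\<lambda>x. complex_of_real (f x) | f. flat_sum c f}"
  then obtain f where h: "h = (\<lambda>x. complex_of_real (f x))" and "flat_sum c f" by blast
  from \<open>flat_sum c f\<close> have "\<exists>f'. flat_sum c f' \<and> (\<forall>x. (f has_real_derivative f' x) (at x))"
  proof induction
    case (flat a k)
    have "((\<lambda>x. a * flat k c x) has_real_derivative
        (a * c) * flat (k + 2) c x + (- a * real k) * flat (k + 1) c x) (at x)" for x
      by (rule DERIV_cong[OF DERIV_cmult[OF flat_deriv[OF assms]]]) (simp add: algebra_simps)
    then show ?case
      using flat_sum.add[OF flat_sum.flat flat_sum.flat] by blast
  next
    case (add f g)
    then obtain f' g' where "flat_sum c f'" "flat_sum c g'"
      "\<And>x. (f has_real_derivative f' x) (at x)" "\<And>x. (g has_real_derivative g' x) (at x)"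
      by blast
    then show ?case
      by (intro exI[of _ "\<lambda>x. f' x + g' x"]) (auto intro!: flat_sum.add derivative_intros)
  qed
  then obtain f' where "flat_sum c f'" "\<And>x. (f has_real_derivative f' x) (at x)" by blast
  then show "\<exists>h'\<in>{\<lambda>x. complex_of_real (f x) | f. flat_sum c f}. \<forall>x. (h has_vector_derivative h' x) (at x)"
    unfolding h
    by (intro bexI[of _ "\<lambda>x. complex_of_real (f' x)"])
      (auto intro!: has_vector_derivative_of_real simp: has_real_derivative_iff_has_vector_derivative[symmetric])
qed

text \<open>A single parameter \<open>c\<close> both keeps the support away from \<open>a\<close> and
  \<open>b\<close> and makes the profile steep, so that \<open>cutoff a b c\<close> converges to the indicator
  of \<open>(a,b)\<close> as \<open>c \<rightarrow> 0\<close>. That the distance to the end points and the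
  steepness are the same \<open>c\<close> is what makes \<open>flat_2_weighted_bound\<close> uniform.\<close>

definition cutoff :: "real \<Rightarrow> real \<Rightarrow> real \<Rightarrow> real \<Rightarrow> real" where
  "cutoff a b c x = flat 0 c (x - a - c) * flat 0 c (b - c - x)"

lemma smooth_cutoff:
  assumes "c > 0"
  shows "smooth (\<lambda>x. complex_of_real (cutoff a b c x))"
  using smooth_mult[OF smooth_affine[OF smooth_flat[OF assms], of 1 0 1 "-a-c"]
      smooth_affine[OF smooth_flat[OF assms], of 1 0 "-1" "b-c"]]
  by (simp add: cutoff_def algebra_simps)

lemma flat_0_le_1: "c > 0 \<Longrightarrow> 0 \<le> flat 0 c x \<and> flat 0 c x \<le> 1"
  by (auto simp: flat_def)

lemma cutoff_bounds: "c > 0 \<Longrightarrow> 0 \<le> cutoff a b c x \<and> cutoff a b c x \<le> 1"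
  using flat_0_le_1[of c "x - a - c"] flat_0_le_1[of c "b - c - x"]
  by (auto simp: cutoff_def mult_le_one)

lemma cutoff_support: "cutoff a b c x \<noteq> 0 \<Longrightarrow> x \<in> {a + c..b - c}"
  by (auto simp: cutoff_def flat_def split: if_splits)

text \<open>The exponential factor tends to 1 as \<open>c \<rightarrow> 0\<close>, as long as the argument
  stays away from 0.\<close>

lemma flat_tendsto_param:
  assumes "(\<lambda>j. c j) \<longlonglongrightarrow> 0" "(\<lambda>j. y j) \<longlonglongrightarrow> y0" "y0 > 0"
  shows "(\<lambda>j. flat k (c j) (y j)) \<longlonglongrightarrow> inverse y0 ^ k"
proof -
  have "(\<lambda>j. inverse (y j) ^ k * exp (- c j * inverse (y j))) \<longlonglongrightarrow> inverse y0 ^ k * exp (- 0 * inverse y0)"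
    using assms by (intro tendsto_intros) auto
  moreover have "\<forall>\<^sub>F j in sequentially. inverse (y j) ^ k * exp (- c j * inverse (y j)) = flat k (c j) (y j)"
    using order_tendstoD(1)[OF assms(2,3)] by eventually_elim (simp add: flat_def)
  ultimately show ?thesis
    using Lim_transform_eventually by fastforce
qed

lemma cutoff_tendsto:
  assumes "(\<lambda>j. c j) \<longlonglongrightarrow> 0" "x \<in> {a<..<b}"
  shows "(\<lambda>j. cutoff a b (c j) x) \<longlonglongrightarrow> 1"
proof -
  have "(\<lambda>j. x - a - c j) \<longlonglongrightarrow> x - a - 0" "(\<lambda>j. b - c j - x) \<longlonglongrightarrow> b - 0 - x"
    by (rule tendsto_diff[OF tendsto_const assms(1)]
        tendsto_diff[OF tendsto_diff[OF tendsto_const assms(1)] tendsto_const])+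
  then have "(\<lambda>j. cutoff a b (c j) x) \<longlonglongrightarrow> inverse (x - a) ^ 0 * inverse (b - x) ^ 0"
    unfolding cutoff_def using assms
    by (intro tendsto_mult flat_tendsto_param) auto
  then show ?thesis by simp
qed

lemma test_function_iff_smooth:
  "test_function L \<eta> \<longleftrightarrow>
     smooth \<eta> \<and> (\<exists>K. compact K \<and> K \<subseteq> {0<..<L} \<and> (\<forall>x. x \<notin> K \<longrightarrow> \<eta> x = 0))"
  by (simp add: test_function_def smooth_def)

lemma test_function_mult_cutoff:
  assumes "c > 0" "a \<ge> 0" "b \<le> L" "smooth f"
  shows "test_function L (\<lambda>x. f x * complex_of_real (cutoff a b c x))"
  unfolding test_function_iff_smooth
proof
  show "smooth (\<lambda>x. f x * complex_of_real (cutoff a b c x))"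
    using assms by (intro smooth_mult smooth_cutoff)
  show "\<exists>K. compact K \<and> K \<subseteq> {0<..<L} \<and> (\<forall>x. x \<notin> K \<longrightarrow> f x * complex_of_real (cutoff a b c x) = 0)"
    using assms cutoff_support[of a b c] by (intro exI[of _ "{a + c..b - c}"]) fastforce
qed

lemma test_function_vanish:
  "test_function L \<eta> \<Longrightarrow> x \<notin> {0<..<L} \<Longrightarrow> \<eta> x = 0"
  by (auto simp: test_function_def)

lemma test_function_deriv:
  assumes "test_function L \<eta>"
  shows "test_function L (\<lambda>x. vector_derivative \<eta> (at x))"
    and "(\<eta> has_vector_derivative vector_derivative \<eta> (at x)) (at x)"
proof -
  obtain K where K: "compact K" "K \<subseteq> {0<..<L}" "\<And>x. x \<notin> K \<Longrightarrow> \<eta> x = 0"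
    and "smooth \<eta>"
    using assms by (auto simp: test_function_iff_smooth)
  obtain \<eta>' where \<eta>': "smooth \<eta>'" "\<And>x. (\<eta> has_vector_derivative \<eta>' x) (at x)"
    using smooth_deriv[OF \<open>smooth \<eta>\<close>] by blast
  then have eq: "vector_derivative \<eta> (at x) = \<eta>' x" for x
    by (simp add: vector_derivative_at)
  have "\<eta>' x = 0" if "x \<notin> K" for x
  proof -
    have "((\<lambda>_. 0 :: complex) has_vector_derivative \<eta>' x) (at x)"
      by (rule has_vector_derivative_transform_within_open[OF \<eta>'(2), of "- K"])
        (use that K in \<open>auto intro!: open_Compl compact_imp_closed\<close>)
    then show ?thesis
      by (metis has_vector_derivative_const vector_derivative_unique_at)
  qed
  with \<eta>' K show "test_function L (\<lambda>x. vector_derivative \<eta> (at x))"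
    unfolding eq test_function_iff_smooth by blast
  show "(\<eta> has_vector_derivative vector_derivative \<eta> (at x)) (at x)"
    using \<eta>' eq by simp
qed

section \<open>Weak derivatives\<close>

lemma L2_eq_zeroI:
  assumes "AE x in lborel. rep_L2 f x = 0"
  shows "f = 0"
  using abs_L2_eqI[OF square_integrable_rep[of f] square_integrable_zero] assms
  by (simp add: zero_L2_def)

text \<open>The sets over which the integral vanishes form a Dynkin system; it contains the intervals, which
  generate the Borel sets and are stable under intersection.\<close>

lemma integrable_zero_on_intervals:
  fixes G :: "real \<Rightarrow> complex"
  assumes G: "integrable lborel G"
    and intervals: "\<And>a b. (LINT x:{a<..<b}|lborel. G x) = 0" and total: "(LINT x|lborel. G x) = 0"
  shows "AE x in lborel. G x = 0"
proof (rule sigma_finite_measure.density_zero[OF sigma_finite_lborel G])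
  fix A :: "real set" assume "A \<in> sets lborel"
  let ?I = "range (\<lambda>(a::real, b). {a<..<b})"
  have borel_eq: "(borel :: real measure) = sigma UNIV ?I"
    using borel_eq_box[where ?'a = real] by (simp add: box_real)
  have "Int_stable ?I"
  proof (rule Int_stableI)
    fix a b assume "a \<in> ?I" "b \<in> ?I"
    then obtain p q r s where "a = {p<..<q}" "b = {r<..<s}" by auto
    then have "a \<inter> b = {max p r<..<min q s}" by auto
    then show "a \<inter> b \<in> ?I" by auto
  qed
  moreover have "?I \<subseteq> Pow UNIV" by simp
  moreover have "A \<in> sigma_sets UNIV ?I"
    using \<open>A \<in> sets lborel\<close> by (simp add: borel_eq)
  ultimately show "(LINT x:A|lborel. G x) = 0"
  proof (induction rule: sigma_sets_induct_disjoint)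
    case (basic A)
    then show ?case using intervals by auto
  next
    case empty
    show ?case by (simp add: set_lebesgue_integral_def)
  next
    case (compl A)
    then have A: "A \<in> sets lborel" by (simp add: borel_eq)
    have int: "integrable lborel (\<lambda>x. indicator A x *\<^sub>R G x)"
      using integrable_mult_indicator[OF A G] .
    have "(LINT x:UNIV - A|lborel. G x) = (LINT x|lborel. G x - indicator A x *\<^sub>R G x)"
      unfolding set_lebesgue_integral_def
      by (intro Bochner_Integration.integral_cong) (auto simp: indicator_def)
    also have "\<dots> = 0"
      using Bochner_Integration.integral_diff[OF G int] total compl.IH
      by (simp add: set_lebesgue_integral_def)
    finally show ?case .
  next
    case (union A)
    then have A: "A i \<in> sets lborel" for i by (auto simp: borel_eq)
    have "(LINT x:(\<Union>i. A i)|lborel. G x) = (\<Sum>i. (LINT x:(A i)|lborel. G x))"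
      using union.hyps A G
      by (intro lebesgue_integral_countable_add)
        (auto simp: disjoint_family_on_def set_integrable_def intro!: integrable_mult_indicator)
    then show ?case using union.IH by simp
  qed
qed

text \<open>Cut-offs are test functions and converge boundedly to indicators of intervals, so by dominated
  convergence the integral of \<open>f\<close> over every subinterval of \<open>(0,L)\<close>
  vanishes.\<close>

lemma fundamental_lemma_variations:
  assumes f: "f \<in> L2_on L"
    and test: "\<And>\<eta>. test_function L \<eta> \<Longrightarrow> (LINT x:{0<..<L}|lborel. rep_L2 f x * \<eta> x) = 0"
  shows "f = 0"
proof -
  define G where "G = (\<lambda>x. indicator {0<..<L} x *\<^sub>R rep_L2 f x)"
  have G: "integrable lborel G"
    using set_integrable_rep_mult[of "\<lambda>_. 1" L f] by (simp add: G_def set_integrable_def)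
  then have G_meas [measurable]: "G \<in> borel_measurable lborel" by simp
  have inner: "(LINT x:{a<..<b}|lborel. G x) = 0" if ab: "0 \<le> a" "b \<le> L" for a b
  proof -
    define c where "c j = inverse (real (Suc j))" for j
    have c: "c j > 0" "c \<longlonglongrightarrow> 0" for j
      unfolding c_def using LIMSEQ_inverse_real_of_nat by auto
    have zero: "(LINT x|lborel. cutoff a b (c j) x *\<^sub>R G x) = 0" for j
    proof -
      have "test_function L (\<lambda>x. 1 * complex_of_real (cutoff a b (c j) x))"
        by (intro test_function_mult_cutoff ab c) (use smooth_trig[of 1 0 0] in simp)
      from test[OF this] show ?thesis
        by (simp add: set_lebesgue_integral_def G_def scaleR_conv_of_real ac_simps)
    qed
    have "(\<lambda>j. LINT x|lborel. cutoff a b (c j) x *\<^sub>R G x)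
        \<longlonglongrightarrow> (LINT x|lborel. indicator {a<..<b} x *\<^sub>R G x)"
    proof (rule Bochner_Integration.integral_dominated_convergence[where w = "\<lambda>x. cmod (G x)"])
      show "(\<lambda>x. cutoff a b (c j) x *\<^sub>R G x) \<in> borel_measurable lborel" for j
        unfolding cutoff_def flat_def by measurable
      show "AE x in lborel. (\<lambda>j. cutoff a b (c j) x *\<^sub>R G x) \<longlonglongrightarrow> indicator {a<..<b} x *\<^sub>R G x"
      proof (intro AE_I2 tendsto_scaleR tendsto_const)
        fix x
        show "(\<lambda>j. cutoff a b (c j) x) \<longlonglongrightarrow> indicator {a<..<b} x"
        proof (cases "x \<in> {a<..<b}")
          case True
          then show ?thesis using cutoff_tendsto[OF c(2)] by simp
        next
          case False
          have "cutoff a b (c j) x = 0" for j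
            using cutoff_support[of a b "c j" x] False c(1)[of j] by force
          then show ?thesis using False by simp
        qed
      qed
      show "AE x in lborel. norm (cutoff a b (c j) x *\<^sub>R G x) \<le> cmod (G x)" for j
        using cutoff_bounds[OF c(1)] by (auto intro!: mult_left_le_one_le)
    qed (use G in auto)
    then show ?thesis
      unfolding zero by (simp add: LIMSEQ_const_iff set_lebesgue_integral_def)
  qed
  have "AE x in lborel. G x = 0"
  proof (rule integrable_zero_on_intervals[OF G])
    fix a b
    have "(LINT x:{a<..<b}|lborel. G x) = (LINT x:{max 0 a<..<min L b}|lborel. G x)"
      unfolding set_lebesgue_integral_def
      by (intro Bochner_Integration.integral_cong) (auto simp: G_def indicator_def)
    then show "(LINT x:{a<..<b}|lborel. G x) = 0" using inner by simp
  next
    have "(LINT x|lborel. G x) = (LINT x:{0<..<L}|lborel. G x)"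
      unfolding set_lebesgue_integral_def
      by (intro Bochner_Integration.integral_cong) (auto simp: G_def indicator_def)
    then show "(LINT x|lborel. G x) = 0" using inner by simp
  qed
  moreover have "AE x in lborel. x \<notin> {0<..<L} \<longrightarrow> rep_L2 f x = 0"
    using f by (simp add: L2_on_def)
  ultimately have "AE x in lborel. rep_L2 f x = 0"
    by eventually_elim (auto simp: G_def indicator_def split: if_splits)
  then show ?thesis by (rule L2_eq_zeroI)
qed

lemma test_function_continuous: "test_function L \<eta> \<Longrightarrow> continuous_on S \<eta>"
  by (simp add: test_function_iff_smooth smooth_continuous)

lemma is_weak_deriv_zero: "is_weak_deriv L 0 0"
  by (simp add: is_weak_deriv_def set_integral_rep_zero)

lemma is_weak_deriv_add:
  "is_weak_deriv L f f' \<Longrightarrow> is_weak_deriv L g g' \<Longrightarrow> is_weak_deriv L (f + g) (f' + g')"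
  unfolding is_weak_deriv_def
  using test_function_continuous[of L _ UNIV] test_function_continuous[OF test_function_deriv(1), of L _ UNIV]
  by (simp add: set_integral_rep_mult_add)

lemma is_weak_deriv_scaleC:
  "is_weak_deriv L f f' \<Longrightarrow> is_weak_deriv L (c *\<^sub>C f) (c *\<^sub>C f')"
  unfolding is_weak_deriv_def
  using test_function_continuous[of L _ UNIV] test_function_continuous[OF test_function_deriv(1), of L _ UNIV]
  by (simp add: set_integral_rep_mult_scaleC)

lemma is_weak_deriv_unique:
  assumes "is_weak_deriv L f g" "is_weak_deriv L f h" "g \<in> L2_on L" "h \<in> L2_on L"
  shows "g = h"
proof -
  have "g + (-1) *\<^sub>C h = 0"
  proof (rule fundamental_lemma_variations)
    show "g + (-1) *\<^sub>C h \<in> L2_on L"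
      using assms complex_subspace_L2_on[of L] by (auto simp: complex_subspace_def)
    fix \<eta> assume \<eta>: "test_function L \<eta>"
    show "(LINT x:{0<..<L}|lborel. rep_L2 (g + (-1) *\<^sub>C h) x * \<eta> x) = 0"
      using assms(1,2) \<eta> 
      by (simp add: is_weak_deriv_def set_integral_rep_mult_add set_integral_rep_mult_scaleC
          test_function_continuous)
  qed
  then show ?thesis by (simp add: scaleC_minus_one)
qed

text \<open>Uniqueness is what gives the definite description in \<open>wderiv\<close> its meaning.\<close>

lemma wderiv_eqI:
  assumes "g \<in> L2_on L" "is_weak_deriv L f g"
  shows "wderiv L f = g"
  unfolding wderiv_def using assms is_weak_deriv_unique by (intro the_equality) auto

lemma H1_I: "f \<in> L2_on L \<Longrightarrow> g \<in> L2_on L \<Longrightarrow> is_weak_deriv L f g \<Longrightarrow> f \<in> H1 L"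
  by (auto simp: H1_def)

lemma H1_D:
  assumes "f \<in> H1 L"
  shows "f \<in> L2_on L" "wderiv L f \<in> L2_on L" "is_weak_deriv L f (wderiv L f)"
  using assms wderiv_eqI by (auto simp: H1_def)

lemma wderiv_zero [simp]: "wderiv L 0 = 0"
  using complex_subspace_L2_on[of L]
  by (intro wderiv_eqI is_weak_deriv_zero) (auto simp: complex_subspace_def)

lemma wderiv_add: "f \<in> H1 L \<Longrightarrow> g \<in> H1 L \<Longrightarrow> wderiv L (f + g) = wderiv L f + wderiv L g"
  using complex_subspace_L2_on[of L]
  by (intro wderiv_eqI is_weak_deriv_add) (auto simp: complex_subspace_def dest: H1_D)

lemma wderiv_scaleC: "f \<in> H1 L \<Longrightarrow> wderiv L (c *\<^sub>C f) = c *\<^sub>C wderiv L f"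
  using complex_subspace_L2_on[of L]
  by (intro wderiv_eqI is_weak_deriv_scaleC) (auto simp: complex_subspace_def dest: H1_D)

lemma complex_subspace_H1: "complex_subspace (H1 L)"
  using complex_subspace_L2_on[of L]
  unfolding complex_subspace_def
  by (intro conjI ballI allI)
    (blast intro: H1_I is_weak_deriv_zero is_weak_deriv_add is_weak_deriv_scaleC dest: H1_D)+

lemma complex_subspace_Int: "complex_subspace A \<Longrightarrow> complex_subspace B \<Longrightarrow> complex_subspace (A \<inter> B)"
  by (auto simp: complex_subspace_def)

lemma complex_subspace_H1_mean_zero: "complex_subspace (H1_mean_zero L)"
  unfolding H1_mean_zero_def
  by (intro complex_subspace_Int complex_subspace_H1 complex_subspace_L2_mean_zero)

lemma set_integral_FTC_Ioo:
  fixes F :: "real \<Rightarrow> 'a::euclidean_space"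
  assumes "L > 0" and deriv: "\<And>x. (F has_vector_derivative f x) (at x)"
    and cont: "continuous_on UNIV f"
  shows "(LINT x:{0<..<L}|lborel. f x) = F L - F 0"
proof -
  have [measurable]: "f \<in> borel_measurable borel"
    using cont by (rule borel_measurable_continuous_onI)
  have "(LINT x:{0<..<L}|lborel. f x) = (LINT x|lborel. indicator {0..L} x *\<^sub>R f x)"
    unfolding set_lebesgue_integral_def
  proof (rule integral_cong_AE)
    show "AE x in lborel. indicat_real {0<..<L} x *\<^sub>R f x = indicat_real {0..L} x *\<^sub>R f x"
      using AE_lborel_singleton[of 0] AE_lborel_singleton[of L]
      by eventually_elim (auto simp: indicator_def)
  qed measurable
  also have "\<dots> = F L - F 0"
    using assms by (intro integral_FTC_Icc has_vector_derivative_at_within[OF deriv]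
        continuous_on_subset[OF cont]) auto
  finally show ?thesis .
qed

text \<open>Integration by parts: the boundary terms vanish because the test function does.\<close>

lemma is_weak_deriv_L2_restrict:
  assumes "L > 0" and f: "\<And>x. (f has_vector_derivative f' x) (at x)"
    and cont: "continuous_on UNIV f'"
  shows "is_weak_deriv L (L2_restrict L f) (L2_restrict L f')"
  unfolding is_weak_deriv_def
proof (intro allI impI)
  fix \<eta> assume \<eta>: "test_function L \<eta>"
  let ?d = "\<lambda>x. vector_derivative \<eta> (at x)"
  have fc: "continuous_on UNIV f"
    using f by (meson continuous_at_imp_continuous_on has_vector_derivative_continuous)
  have \<eta>c: "continuous_on UNIV \<eta>" "continuous_on UNIV ?d"
    using \<eta> test_function_deriv(1) test_function_continuous by blast+
  have "(LINT x:{0<..<L}|lborel. f x * ?d x + f' x * \<eta> x) = f L * \<eta> L - f 0 * \<eta> 0"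
  proof (rule set_integral_FTC_Ioo[OF \<open>L > 0\<close>])
    show "((\<lambda>x. f x * \<eta> x) has_vector_derivative f x * ?d x + f' x * \<eta> x) (at x)" for x
      by (rule has_vector_derivative_mult[OF f test_function_deriv(2)[OF \<eta>]])
    show "continuous_on UNIV (\<lambda>x. f x * ?d x + f' x * \<eta> x)"
      by (intro continuous_on_add continuous_on_mult fc cont \<eta>c)
  qed
  also have "\<dots> = 0"
    using test_function_vanish[OF \<eta>] by simp
  finally have zero: "(LINT x:{0<..<L}|lborel. f x * ?d x + f' x * \<eta> x) = 0" .
  have si: "set_integrable lborel {0<..<L} (\<lambda>x. g x * h x)"
    if "continuous_on UNIV g" "continuous_on UNIV h" for g h :: "real \<Rightarrow> complex"
  proof (rule set_integrable_subset[of _ "{0..L}"])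
    show "set_integrable lborel {0..L} (\<lambda>x. g x * h x)"
      unfolding set_integrable_def
      by (intro borel_integrable_compact continuous_intros continuous_on_subset[OF that(1)]
          continuous_on_subset[OF that(2)]) auto
  qed auto
  have "(LINT x:{0<..<L}|lborel. f x * ?d x) + (LINT x:{0<..<L}|lborel. f' x * \<eta> x) = 0"
    using set_integral_add(2)[OF si[OF fc \<eta>c(2)] si[OF cont \<eta>c(1)]] zero by simp
  then show "(LINT x:{0<..<L}|lborel. rep_L2 (L2_restrict L f) x * ?d x)
     = - (LINT x:{0<..<L}|lborel. rep_L2 (L2_restrict L f') x * \<eta> x)"
    by (simp add: set_integral_L2_restrict fc cont \<eta>c eq_neg_iff_add_eq_0)
qed

lemma L2_restrict_H1:
  assumes "L > 0" and "\<And>x. (f has_vector_derivative f' x) (at x)" and "continuous_on UNIV f'"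
  shows "L2_restrict L f \<in> H1 L" "wderiv L (L2_restrict L f) = L2_restrict L f'"
proof -
  have "continuous_on UNIV f"
    using assms(2) by (meson continuous_at_imp_continuous_on has_vector_derivative_continuous)
  then show "L2_restrict L f \<in> H1 L" "wderiv L (L2_restrict L f) = L2_restrict L f'"
    using is_weak_deriv_L2_restrict[OF assms] assms(3)
    by (blast intro: H1_I wderiv_eqI L2_restrict_in_L2_on)+
qed

section \<open>The closure of the test functions\<close>

lemma tendsto_scaleC_L2:
  assumes "(f \<longlongrightarrow> (l :: L2)) F"
  shows "((\<lambda>x. c *\<^sub>C f x) \<longlongrightarrow> c *\<^sub>C l) F"
proof -
  have "((\<lambda>x. cmod c * norm (f x - l)) \<longlongrightarrow> cmod c * 0) F"
    using assms by (intro tendsto_mult_left tendsto_norm_zero LIM_zero)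
  then have "((\<lambda>x. norm (c *\<^sub>C f x - c *\<^sub>C l)) \<longlongrightarrow> 0) F"
    by (simp add: norm_scaleC_L2 flip: scaleC_diff_right)
  then show ?thesis
    using LIM_zero_iff tendsto_norm_zero_iff by blast
qed

lemma complex_subspace_closure:
  fixes S :: "(L2 \<times> L2) set"
  assumes "complex_subspace S"
  shows "complex_subspace (closure S)"
  unfolding complex_subspace_def
proof (intro conjI ballI allI)
  show "0 \<in> closure S"
    using assms closure_subset by (auto simp: complex_subspace_def)
next
  fix p q assume "p \<in> closure S" "q \<in> closure S"
  then obtain P Q where "\<And>n. P n \<in> S" "P \<longlonglongrightarrow> p" "\<And>n. Q n \<in> S" "Q \<longlonglongrightarrow> q"
    unfolding closure_sequential by blast
  then show "p + q \<in> closure S"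
    using assms unfolding closure_sequential complex_subspace_def
    by (intro exI[of _ "\<lambda>n. P n + Q n"]) (auto intro!: tendsto_add)
next
  fix c p assume "p \<in> closure S"
  then obtain P where P: "\<And>n. P n \<in> S" "P \<longlonglongrightarrow> p"
    unfolding closure_sequential by blast
  have "(\<lambda>n. c *\<^sub>C P n) \<longlonglongrightarrow> c *\<^sub>C p"
    unfolding scaleC_prod_def by (intro tendsto_Pair tendsto_scaleC_L2 tendsto_fst tendsto_snd P)
  then show "c *\<^sub>C p \<in> closure S"
    using assms P(1) unfolding closure_sequential complex_subspace_def
    by (intro exI[of _ "\<lambda>n. c *\<^sub>C P n"]) auto
qed

lemma abs_L2_test_function:
  assumes "test_function L \<eta>"
  shows "abs_L2 \<eta> = L2_restrict L \<eta>"
proof -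
  have "(\<lambda>x. indicator {0<..<L} x * \<eta> x) = \<eta>"
    using test_function_vanish[OF assms] by (auto simp: indicator_def fun_eq_iff)
  then show ?thesis by (simp add: L2_restrict_def)
qed

lemma square_integrable_test_function:
  assumes "test_function L \<eta>"
  shows "square_integrable \<eta>"
proof -
  have "(\<lambda>x. indicator {0<..<L} x * \<eta> x) = \<eta>"
    using test_function_vanish[OF assms] by (auto simp: indicator_def fun_eq_iff)
  then show ?thesis
    using square_integrable_restrict[OF test_function_continuous[OF assms], of L] by simp
qed

lemma test_function_zero: "test_function L (\<lambda>_. 0)"
  using smooth_trig[of 0 0 0] by (auto simp: test_function_iff_smooth intro: exI[of _ "{}"])

lemma test_function_add:
  assumes "test_function L \<eta>" "test_function L \<zeta>"
  shows "test_function L (\<lambda>x. \<eta> x + \<zeta> x)"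
proof -
  obtain K K' where "compact K" "K \<subseteq> {0<..<L}" "\<forall>x. x \<notin> K \<longrightarrow> \<eta> x = 0"
    "compact K'" "K' \<subseteq> {0<..<L}" "\<forall>x. x \<notin> K' \<longrightarrow> \<zeta> x = 0"
    using assms unfolding test_function_iff_smooth by blast
  then have "compact (K \<union> K') \<and> K \<union> K' \<subseteq> {0<..<L} \<and> (\<forall>x. x \<notin> K \<union> K' \<longrightarrow> \<eta> x + \<zeta> x = 0)"
    by auto
  then show ?thesis
    using assms smooth_add unfolding test_function_iff_smooth by blast
qed

lemma test_function_scale:
  assumes "test_function L \<eta>"
  shows "test_function L (\<lambda>x. c * \<eta> x)"
proof -
  obtain K where "compact K" "K \<subseteq> {0<..<L}" "\<forall>x. x \<notin> K \<longrightarrow> c * \<eta> x = 0"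
    using assms unfolding test_function_iff_smooth by auto
  moreover have "smooth (\<lambda>x. c * \<eta> x)"
    using assms smooth_affine[of \<eta> c 1 0] by (simp add: test_function_iff_smooth)
  ultimately show ?thesis
    unfolding test_function_iff_smooth by blast
qed

lemma complex_subspace_test_graph:
  "complex_subspace {(abs_L2 \<eta>, abs_L2 (\<lambda>x. vector_derivative \<eta> (at x))) | \<eta>. test_function L \<eta>}"
    (is "complex_subspace ?G")
  unfolding complex_subspace_def
proof (intro conjI ballI allI)
  show "0 \<in> ?G"
    using test_function_zero by (auto simp: zero_L2_def zero_prod_def intro!: exI[of _ "\<lambda>_. 0"])
next
  fix p q assume "p \<in> ?G" "q \<in> ?G"
  then obtain \<eta> \<zeta> where t: "test_function L \<eta>" "test_function L \<zeta>"
    and pq: "p = (abs_L2 \<eta>, abs_L2 (\<lambda>x. vector_derivative \<eta> (at x)))"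
      "q = (abs_L2 \<zeta>, abs_L2 (\<lambda>x. vector_derivative \<zeta> (at x)))"
    by blast
  have d: "vector_derivative (\<lambda>x. \<eta> x + \<zeta> x) (at x)
      = vector_derivative \<eta> (at x) + vector_derivative \<zeta> (at x)" for x
    by (intro vector_derivative_at has_vector_derivative_add test_function_deriv(2)[OF t(1)] test_function_deriv(2)[OF t(2)])
  have "p + q = (abs_L2 (\<lambda>x. \<eta> x + \<zeta> x), abs_L2 (\<lambda>x. vector_derivative (\<lambda>x. \<eta> x + \<zeta> x) (at x)))"
    unfolding pq d
    by (simp add: abs_L2_add square_integrable_test_function[OF t(1)]
        square_integrable_test_function[OF t(2)]
        square_integrable_test_function[OF test_function_deriv(1)[OF t(1)]]
        square_integrable_test_function[OF test_function_deriv(1)[OF t(2)]])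
  then show "p + q \<in> ?G" using test_function_add[OF t] by blast
next
  fix c p assume "p \<in> ?G"
  then obtain \<eta> where t: "test_function L \<eta>"
    and p: "p = (abs_L2 \<eta>, abs_L2 (\<lambda>x. vector_derivative \<eta> (at x)))"
    by blast
  have d: "vector_derivative (\<lambda>x. c * \<eta> x) (at x) = c * vector_derivative \<eta> (at x)" for x
    by (intro vector_derivative_at has_vector_derivative_mult_right test_function_deriv(2)[OF t])
  have "square_integrable \<eta>" "square_integrable (\<lambda>x. vector_derivative \<eta> (at x))"
    using t test_function_deriv(1) square_integrable_test_function by blast+
  then have "c *\<^sub>C p = (abs_L2 (\<lambda>x. c * \<eta> x), abs_L2 (\<lambda>x. vector_derivative (\<lambda>x. c * \<eta> x) (at x)))"
    unfolding p d by (simp add: abs_L2_scaleC scaleC_prod_def)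
  then show "c *\<^sub>C p \<in> ?G" using test_function_scale[OF t] by blast
qed

lemma complex_subspace_H1_0: "complex_subspace (H1_0 L)"
proof -
  note closed = complex_subspace_closure[OF complex_subspace_test_graph[of L]]
  note H1 = complex_subspace_H1[of L]
  show ?thesis
    unfolding complex_subspace_def
  proof (intro conjI ballI allI)
    show "0 \<in> H1_0 L"
      using closed H1 by (simp add: H1_0_def complex_subspace_def zero_prod_def)
  next
    fix f g assume "f \<in> H1_0 L" "g \<in> H1_0 L"
    then have fg: "f \<in> H1 L" "g \<in> H1 L"
      and "(f, wderiv L f) + (g, wderiv L g) \<in>
        closure {(abs_L2 \<eta>, abs_L2 (\<lambda>x. vector_derivative \<eta> (at x))) | \<eta>. test_function L \<eta>}"
      using closed unfolding H1_0_def complex_subspace_def by blast+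
    then show "f + g \<in> H1_0 L"
      using H1 by (simp add: H1_0_def complex_subspace_def wderiv_add)
  next
    fix c f assume "f \<in> H1_0 L"
    then have f: "f \<in> H1 L"
      and "c *\<^sub>C (f, wderiv L f) \<in>
        closure {(abs_L2 \<eta>, abs_L2 (\<lambda>x. vector_derivative \<eta> (at x))) | \<eta>. test_function L \<eta>}"
      using closed unfolding H1_0_def complex_subspace_def by blast+
    then show "c *\<^sub>C f \<in> H1_0 L"
      using H1 by (simp add: H1_0_def complex_subspace_def wderiv_scaleC scaleC_prod_def)
  qed
qed

text \<open>With \<open>t = c / y\<close> the left-hand side is \<open>(t + t\<^sup>2) exp (- t)\<close>,
  whatever the value of \<open>c\<close>. In \<open>L2_restrict_H1_0\<close> this compensates the growth of
  the derivative of a cut-off near an end point: there \<open>y + c\<close> is the distance to that end point,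
  which bounds a function vanishing at it.\<close>

lemma flat_2_weighted_bound:
  assumes "c > 0"
  shows "0 \<le> c * flat 2 c y" and "c * flat 2 c y * (y + c) \<le> 3"
proof -
  show "0 \<le> c * flat 2 c y" using assms by (simp add: flat_def)
  show "c * flat 2 c y * (y + c) \<le> 3"
  proof (cases "y > 0")
    case True
    define t where "t = c / y"
    have t: "t > 0" using True assms by (simp add: t_def)
    have "c * flat 2 c y * (y + c) = (t + t\<^sup>2) * exp (- t)"
      using True by (simp add: flat_def t_def field_simps power2_eq_square)
    moreover have "t + t\<^sup>2 \<le> 3 * exp t"
      using exp_lower_Taylor_quadratic[of t] t zero_le_power2[of t] by linarith
    then have "(t + t\<^sup>2) * exp (- t) \<le> (3 * exp t) * exp (- t)"
      by (intro mult_right_mono) auto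
    moreover have "(3 * exp t) * exp (- t) = 3" by (simp add: mult.assoc flip: exp_add)
    ultimately show ?thesis by linarith
  qed (simp add: flat_def)
qed

text \<open>The functions \<open>f\<close> times cut-off approximate \<open>f\<close> in the
  \<open>H\<^sup>1\<close>-norm. By the Leibniz rule, the only problematic part of their derivatives is
  \<open>f\<close> times the derivative of the cut-off. It tends to 0 pointwise, and it is bounded uniformly
  because \<open>f\<close> vanishes at least linearly at both end points.\<close>

lemma L2_restrict_H1_0:
  assumes L: "L > 0" and f: "smooth f" and zero: "f 0 = 0" "f L = 0"
  shows "L2_restrict L f \<in> H1_0 L"
proof -
  obtain f' where f': "smooth f'" "\<And>x. (f has_vector_derivative f' x) (at x)"
    using smooth_deriv[OF f] by blast
  note cont = smooth_continuous[OF f, of UNIV] smooth_continuous[OF f'(1), of UNIV]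
  have H1: "L2_restrict L f \<in> H1 L" "wderiv L (L2_restrict L f) = L2_restrict L f'"
    using L2_restrict_H1[OF L f'(2) cont(2)] by auto
  have "bounded (f' ` {0..L})"
    using smooth_continuous[OF f'(1)] by (intro compact_imp_bounded compact_continuous_image) auto
  then obtain B where "\<And>x. x \<in> {0..L} \<Longrightarrow> cmod (f' x) \<le> B"
    unfolding bounded_iff by blast
  then have B: "cmod (f' x) \<le> B" if "x \<in> {0..L}" for x using that .
  have "B \<ge> 0" using order_trans[OF norm_ge_zero B[of 0]] L by simp
  have lipschitz: "cmod (f x - f y) \<le> B * \<bar>x - y\<bar>" if "x \<in> {0..L}" "y \<in> {0..L}" for x y
  proof -
    have "norm (f x - f y) \<le> B * norm (x - y)"
    proof (rule differentiable_bound[of "{0..L}" f "\<lambda>x h. h *\<^sub>R f' x"])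
      show "(f has_derivative (\<lambda>h. h *\<^sub>R f' z)) (at z within {0..L})" for z
        using has_vector_derivative_at_within[OF f'(2)] by (simp add: has_vector_derivative_def)
      show "onorm (\<lambda>h. h *\<^sub>R f' z) \<le> B" if "z \<in> {0..L}" for z
        using B[OF that] by (intro onorm_le) (simp add: mult.commute[of B] mult_left_mono)
    qed (use that in auto)
    then show ?thesis by simp
  qed
  define c where "c j = inverse (real (Suc j))" for j
  have c: "c j > 0" "c \<longlonglongrightarrow> 0" for j
    unfolding c_def using LIMSEQ_inverse_real_of_nat by auto
  define w where "w j x = cutoff 0 L (c j) x" for j x
  define w' where "w' j x = c j * flat 2 (c j) (x - c j) * flat 0 (c j) (L - c j - x)
    - flat 0 (c j) (x - c j) * (c j * flat 2 (c j) (L - c j - x))" for j x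
  define \<eta> where "\<eta> j x = f x * complex_of_real (w j x)" for j x
  define \<eta>' where "\<eta>' j x = f x * complex_of_real (w' j x) + f' x * complex_of_real (w j x)" for j x
  have test: "test_function L (\<eta> j)" for j
    unfolding \<eta>_def[abs_def] w_def by (rule test_function_mult_cutoff[OF c(1) _ _ f]) auto
  have "(w j has_real_derivative w' j x) (at x)" for j x
  proof -
    have flat0: "(flat 0 (c j) has_real_derivative c j * flat 2 (c j) y) (at y)" for y
      using flat_deriv[OF c(1), of 0 j y] by (simp add: numeral_2_eq_2)
    have "((\<lambda>x. flat 0 (c j) (x - 0 - c j)) has_real_derivative
        c j * flat 2 (c j) (x - 0 - c j) * 1) (at x)"
      by (rule DERIV_chain2[OF flat0]) (auto intro!: derivative_eq_intros)
    moreover have "((\<lambda>x. flat 0 (c j) (L - c j - x)) has_real_derivative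
        c j * flat 2 (c j) (L - c j - x) * (-1)) (at x)"
      by (rule DERIV_chain2[OF flat0]) (auto intro!: derivative_eq_intros)
    ultimately show ?thesis
      unfolding w_def[abs_def] cutoff_def
      by (rule DERIV_cong[OF DERIV_mult]) (simp add: w'_def)
  qed
  then have deriv: "(\<eta> j has_vector_derivative \<eta>' j x) (at x)" for j x
    unfolding \<eta>_def \<eta>'_def
    by (intro has_vector_derivative_mult f' has_vector_derivative_of_real)
      (simp add: has_real_derivative_iff_has_vector_derivative)
  have \<eta>'_eq: "\<eta>' j = (\<lambda>x. vector_derivative (\<eta> j) (at x))" for j
    using vector_derivative_at[OF deriv] by (simp add: fun_eq_iff)
  have bounds: "cmod (\<eta> j x) \<le> B * L" "cmod (\<eta>' j x) \<le> 7 * B"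
    and limits: "(\<lambda>j. \<eta> j x) \<longlonglongrightarrow> f x" "(\<lambda>j. \<eta>' j x) \<longlonglongrightarrow> f' x"
    if x: "x \<in> {0<..<L}" for j x
  proof -
    have fx: "cmod (f x) \<le> B * x" "cmod (f x) \<le> B * (L - x)"
      using lipschitz[of x 0] lipschitz[of x L] x zero by auto
    have w: "0 \<le> w j x" "w j x \<le> 1"
      using cutoff_bounds[OF c(1)] by (auto simp: w_def)
    have "cmod (\<eta> j x) \<le> (B * x) * 1"
      using fx w \<open>B \<ge> 0\<close> x unfolding \<eta>_def norm_mult by (intro mult_mono) auto
    also have "\<dots> \<le> B * L"
      using x \<open>B \<ge> 0\<close> by (simp add: mult_left_mono)
    finally show "cmod (\<eta> j x) \<le> B * L" .
    \<comment> \<open>the derivative of each flat factor weighted by the distance to its end point is at most 3, which with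
      the Lipschitz constant \<open>B\<close> contributes \<open>3 B\<close> for each end point; the term with \<open>f'\<close> contributes \<open>B\<close>\<close>
    let ?p = "c j * flat 2 (c j) (x - c j)" and ?q = "c j * flat 2 (c j) (L - c j - x)"
    have p: "0 \<le> ?p" "?p * x \<le> 3" and q: "0 \<le> ?q" "?q * (L - x) \<le> 3"
      using flat_2_weighted_bound[OF c(1), of j "x - c j"]
        flat_2_weighted_bound[OF c(1), of j "L - c j - x"] by (simp_all add: algebra_simps)
    let ?g = "flat 0 (c j) (L - c j - x)" and ?h = "flat 0 (c j) (x - c j)"
    have g: "0 \<le> ?g" "?g \<le> 1" and h: "0 \<le> ?h" "?h \<le> 1"
      using flat_0_le_1[OF c(1)] by auto
    have "0 \<le> ?p * ?g" "?p * ?g \<le> ?p" "0 \<le> ?h * ?q" "?h * ?q \<le> ?q"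
      by (rule mult_nonneg_nonneg mult_right_le_one_le mult_left_le_one_le p(1) q(1) g h)+
    then have "\<bar>w' j x\<bar> \<le> ?p + ?q"
      unfolding w'_def by linarith
    then have "cmod (f x) * \<bar>w' j x\<bar> \<le> cmod (f x) * (?p + ?q)"
      by (intro mult_left_mono) auto
    also have "\<dots> = cmod (f x) * ?p + cmod (f x) * ?q"
      by (simp add: distrib_left)
    also have "\<dots> \<le> (B * x) * ?p + (B * (L - x)) * ?q"
      using fx p q by (intro add_mono mult_right_mono) auto
    also have "\<dots> = B * (?p * x) + B * (?q * (L - x))" by (simp add: algebra_simps)
    also have "\<dots> \<le> B * 3 + B * 3"
      using p q \<open>B \<ge> 0\<close> by (intro add_mono mult_left_mono) auto
    finally have "cmod (f x) * \<bar>w' j x\<bar> \<le> 6 * B" by simp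
    moreover have "cmod (f' x) * \<bar>w j x\<bar> \<le> B * 1"
      using B[of x] x w \<open>B \<ge> 0\<close> by (intro mult_mono) auto
    ultimately show "cmod (\<eta>' j x) \<le> 7 * B"
      unfolding \<eta>'_def by (intro order_trans[OF norm_triangle_ineq]) (simp add: norm_mult)
    have w_lim: "(\<lambda>j. w j x) \<longlonglongrightarrow> 1"
      unfolding w_def using x by (intro cutoff_tendsto c) auto
    have shift: "(\<lambda>j. x - c j) \<longlonglongrightarrow> x" "(\<lambda>j. L - c j - x) \<longlonglongrightarrow> L - x"
      using tendsto_diff[OF tendsto_const c(2), of x]
        tendsto_diff[OF tendsto_diff[OF tendsto_const c(2), of L] tendsto_const, of x] by auto
    have "(\<lambda>j. w' j x) \<longlonglongrightarrow> 0 * inverse x ^ 2 * inverse (L - x) ^ 0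
        - inverse x ^ 0 * (0 * inverse (L - x) ^ 2)"
      unfolding w'_def using x by (intro tendsto_intros flat_tendsto_param c shift) auto
    then have w'_lim: "(\<lambda>j. w' j x) \<longlonglongrightarrow> 0" by simp
    have "(\<lambda>j. \<eta> j x) \<longlonglongrightarrow> f x * complex_of_real 1"
      unfolding \<eta>_def by (intro tendsto_intros w_lim)
    then show "(\<lambda>j. \<eta> j x) \<longlonglongrightarrow> f x" by simp
    have "(\<lambda>j. \<eta>' j x) \<longlonglongrightarrow> f x * complex_of_real 0 + f' x * complex_of_real 1"
      unfolding \<eta>'_def by (intro tendsto_intros w_lim w'_lim)
    then show "(\<lambda>j. \<eta>' j x) \<longlonglongrightarrow> f' x" by simp
  qed
  have test': "test_function L (\<eta>' j)" for j
    unfolding \<eta>'_eq by (rule test_function_deriv(1)[OF test])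
  have "(\<lambda>j. (L2_restrict L (\<eta> j), L2_restrict L (\<eta>' j))) \<longlonglongrightarrow> (L2_restrict L f, L2_restrict L f')"
    by (intro tendsto_Pair L2_restrict_tendsto[where B = "B * L"] L2_restrict_tendsto[where B = "7 * B"]
        test_function_continuous[OF test] test_function_continuous[OF test'] cont bounds limits)
  moreover have "(L2_restrict L (\<eta> j), L2_restrict L (\<eta>' j))
      \<in> {(abs_L2 \<eta>, abs_L2 (\<lambda>x. vector_derivative \<eta> (at x))) | \<eta>. test_function L \<eta>}" for j
  proof -
    have "(L2_restrict L (\<eta> j), L2_restrict L (\<eta>' j))
        = (abs_L2 (\<eta> j), abs_L2 (\<lambda>x. vector_derivative (\<eta> j) (at x)))"
      using abs_L2_test_function[OF test[of j]] abs_L2_test_function[OF test'[of j]]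
      by (simp add: \<eta>'_eq)
    then show ?thesis using test[of j] by blast
  qed
  ultimately have "(L2_restrict L f, L2_restrict L f')
      \<in> closure {(abs_L2 \<eta>, abs_L2 (\<lambda>x. vector_derivative \<eta> (at x))) | \<eta>. test_function L \<eta>}"
    unfolding closure_sequential
    by (intro exI[of _ "\<lambda>j. (L2_restrict L (\<eta> j), L2_restrict L (\<eta>' j))"]) simp
  then show ?thesis
    unfolding H1_0_def using H1 by simp
qed

section \<open>The energy norm\<close>

lemma complex_subspace_Times:
  "complex_subspace A \<Longrightarrow> complex_subspace B \<Longrightarrow> complex_subspace (A \<times> B)"
  by (auto simp: complex_subspace_def scaleC_prod_def zero_prod_def)

lemma complex_subspace_state_space: "complex_subspace (state_space L)"
  unfolding state_space_def
  by (intro complex_subspace_Times complex_subspace_H1_mean_zero complex_subspace_L2_mean_zero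
      complex_subspace_H1_0 complex_subspace_L2_on)

lemma state_cases:
  fixes x :: state
  obtains u v \<phi> \<Phi> \<psi> \<Psi> \<theta> q where "x = (u, v, \<phi>, \<Phi>, \<psi>, \<Psi>, \<theta>, q)"
  by (metis surj_pair)

text \<open>Up to the weights, the energy norm is the norm of the image of the state under a linear map
  \<open>J\<close> into a ninefold product of \<open>L\<^sup>2\<close> spaces; linearity of \<open>J\<close>
  rests on that of the weak derivative.\<close>

lemma energy_seminorm:
  assumes "\<rho> > 0" "\<rho>\<^sub>1 > 0" "\<rho>\<^sub>2 > 0" "\<rho>\<^sub>3 > 0" "\<alpha> > 0" "\<kappa> > 0" "b > 0" "\<tau> > 0" "\<beta> > 0"
  shows "seminormed_subspace (state_space L) (energy_norm L \<rho> \<rho>\<^sub>1 \<rho>\<^sub>2 \<rho>\<^sub>3 \<alpha> \<kappa> b \<tau> \<beta>)"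
    (is "seminormed_subspace _ ?N")
proof
  show "complex_subspace (state_space L)" by (rule complex_subspace_state_space)
next
  fix x assume "x \<in> state_space L"
  show "0 \<le> ?N x"
    using assms by (cases x rule: state_cases) (auto simp: energy_norm_def intro!: add_nonneg_nonneg mult_nonneg_nonneg)
next
  define J :: "state \<Rightarrow> L2 \<times> L2 \<times> L2 \<times> L2 \<times> L2 \<times> L2 \<times> L2 \<times> L2 \<times> L2"
    where "J = (\<lambda>(u, v, \<phi>, \<Phi>, \<psi>, \<Psi>, \<theta>, q).
    (sqrt \<rho> *\<^sub>R v, sqrt \<alpha> *\<^sub>R wderiv L u, sqrt \<rho>\<^sub>1 *\<^sub>R \<Phi>, sqrt \<rho>\<^sub>2 *\<^sub>R \<Psi>, sqrt b *\<^sub>R wderiv L \<psi>,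
     sqrt \<beta> *\<^sub>R (\<phi> - u), sqrt \<kappa> *\<^sub>R (wderiv L \<phi> + \<psi>), sqrt \<rho>\<^sub>3 *\<^sub>R \<theta>, sqrt \<tau> *\<^sub>R q))"
  have N_eq: "?N x = norm (J x)" for x
    using assms by (cases x rule: state_cases) (simp add: J_def energy_norm_def norm_Pair power_mult_distrib
        add_nonneg_nonneg add.assoc)
  fix x y assume "x \<in> state_space L" "y \<in> state_space L"
  then have "J (x + y) = J x + J y"
    by (cases x rule: state_cases; cases y rule: state_cases)
      (auto simp: J_def state_space_def H1_mean_zero_def H1_0_def wderiv_add algebra_simps)
  then show "?N (x + y) \<le> ?N x + ?N y"
    by (simp add: N_eq norm_triangle_ineq)
next
  fix x c assume x: "x \<in> state_space L"
  obtain u v \<phi> \<Phi> \<psi> \<Psi> \<theta> q where x_eq: "x = (u, v, \<phi>, \<Phi>, \<psi>, \<Psi>, \<theta>, q)" by (cases x rule: state_cases)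
  have "?N (c *\<^sub>C x) = sqrt ((cmod c)\<^sup>2 * (?N x)\<^sup>2)"
    using x assms unfolding x_eq
    by (auto simp: energy_norm_def scaleC_prod_def state_space_def H1_mean_zero_def H1_0_def
        wderiv_scaleC norm_scaleC_L2 power_mult_distrib algebra_simps
        simp flip: scaleC_diff_right scaleC_add_right
        intro!: add_nonneg_nonneg mult_nonneg_nonneg)
  also have "\<dots> = cmod c * ?N x"
    using assms by (cases x rule: state_cases)
      (auto simp: energy_norm_def real_sqrt_mult intro!: add_nonneg_nonneg mult_nonneg_nonneg)
  finally show "?N (c *\<^sub>C x) = cmod c * ?N x" .
qed

section \<open>Trigonometric modes\<close>

definition sine_mode :: "real \<Rightarrow> real \<Rightarrow> L2" where
  "sine_mode L k = L2_restrict L (\<lambda>x. complex_of_real (sin (k * x)))"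

definition cosine_mode :: "real \<Rightarrow> real \<Rightarrow> L2" where
  "cosine_mode L k = L2_restrict L (\<lambda>x. complex_of_real (cos (k * x)))"

context
  fixes L k :: real
  assumes L: "L > 0" and k: "k > 0" and node: "sin (k * L) = 0"
begin

lemma sine_mode_H1_0: "sine_mode L k \<in> H1_0 L"
  unfolding sine_mode_def using smooth_trig[of 0 k 1] L node
  by (intro L2_restrict_H1_0) auto

lemma sine_mode_wderiv: "wderiv L (sine_mode L k) = complex_of_real k *\<^sub>C cosine_mode L k"
proof -
  have "wderiv L (sine_mode L k) = L2_restrict L (\<lambda>x. complex_of_real k * complex_of_real (cos (k * x)))"
    unfolding sine_mode_def
  proof (rule L2_restrict_H1(2)[OF L])
    have "((\<lambda>x. sin (k * x)) has_real_derivative k * cos (k * x)) (at x)" for x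
      by (auto intro!: derivative_eq_intros)
    then have "((\<lambda>x. complex_of_real (sin (k * x))) has_vector_derivative complex_of_real (k * cos (k * x))) (at x)" for x
      by (intro has_vector_derivative_of_real) (simp add: has_real_derivative_iff_has_vector_derivative)
    then show "((\<lambda>x. complex_of_real (sin (k * x))) has_vector_derivative complex_of_real k * complex_of_real (cos (k * x))) (at x)" for x
      by simp
  qed (intro continuous_intros)
  then show ?thesis
    unfolding cosine_mode_def by (subst scaleC_L2_restrict) (auto intro!: continuous_intros)
qed

lemma cosine_mode_H1_wderiv:
  shows "cosine_mode L k \<in> H1 L"
    and "wderiv L (cosine_mode L k) = (- complex_of_real k) *\<^sub>C sine_mode L k"
proof -
  have "((\<lambda>x. cos (k * x)) has_real_derivative - k * sin (k * x)) (at x)" for x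
    by (auto intro!: derivative_eq_intros)
  then have "((\<lambda>x. complex_of_real (cos (k * x))) has_vector_derivative complex_of_real (- k * sin (k * x))) (at x)" for x
    by (intro has_vector_derivative_of_real) (simp add: has_real_derivative_iff_has_vector_derivative)
  then have d: "((\<lambda>x. complex_of_real (cos (k * x))) has_vector_derivative - complex_of_real k * complex_of_real (sin (k * x))) (at x)" for x
    by simp
  have c: "continuous_on UNIV (\<lambda>x. - complex_of_real k * complex_of_real (sin (k * x)))"
    by (intro continuous_intros)
  show "cosine_mode L k \<in> H1 L"
    unfolding cosine_mode_def by (rule L2_restrict_H1(1)[OF L d c])
  have "wderiv L (cosine_mode L k) = L2_restrict L (\<lambda>x. - complex_of_real k * complex_of_real (sin (k * x)))"
    unfolding cosine_mode_def by (rule L2_restrict_H1(2)[OF L d c])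
  then show "wderiv L (cosine_mode L k) = (- complex_of_real k) *\<^sub>C sine_mode L k"
    unfolding sine_mode_def by (subst scaleC_L2_restrict) (auto intro!: continuous_intros)
qed

lemma cosine_mode_H1_mean_zero: "cosine_mode L k \<in> H1_mean_zero L"
proof -
  have "(LINT x:{0<..<L}|lborel. rep_L2 (cosine_mode L k) x * 1)
      = (LINT x:{0<..<L}|lborel. complex_of_real (cos (k * x)) * 1)"
    unfolding cosine_mode_def by (rule set_integral_L2_restrict) (auto intro!: continuous_intros)
  also have "\<dots> = complex_of_real (sin (k * L) / k) - complex_of_real (sin (k * 0) / k)"
  proof (rule set_integral_FTC_Ioo[OF L])
    have "((\<lambda>x. sin (k * x) / k) has_real_derivative cos (k * x)) (at x)" for x
      using k by (auto intro!: derivative_eq_intros)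
    then have "((\<lambda>x. complex_of_real (sin (k * x) / k)) has_vector_derivative complex_of_real (cos (k * x))) (at x)" for x
      by (intro has_vector_derivative_of_real) (simp add: has_real_derivative_iff_has_vector_derivative)
    then show "((\<lambda>x. complex_of_real (sin (k * x) / k)) has_vector_derivative complex_of_real (cos (k * x)) * 1) (at x)" for x
      by simp
  qed (intro continuous_intros)
  also have "\<dots> = 0" using node by simp
  finally have "(LINT x:{0<..<L}|lborel. rep_L2 (cosine_mode L k) x) = 0" by simp
  then show ?thesis
    using cosine_mode_H1_wderiv(1) by (auto simp: H1_mean_zero_def L2_mean_zero_def dest: H1_D)
qed

lemma norm_modes:
  shows "(norm (sine_mode L k))\<^sup>2 = L / 2" and "(norm (cosine_mode L k))\<^sup>2 = L / 2"
proof -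
  have sin2: "sin (2 * k * L) = 0"
    using node sin_double[of "k * L"] by (simp add: mult.assoc)
  have "(norm (sine_mode L k))\<^sup>2 = (LINT x:{0<..<L}|lborel. (cmod (complex_of_real (sin (k * x))))\<^sup>2)"
    unfolding sine_mode_def by (intro norm_L2_restrict continuous_intros)
  also have "\<dots> = (L / 2 - sin (2 * k * L) / (4 * k)) - (0 / 2 - sin (2 * k * 0) / (4 * k))"
  proof (rule set_integral_FTC_Ioo[OF L])
    fix x
    have "cos (2 * k * x) = 1 - 2 * (sin (k * x))\<^sup>2"
      using cos_double_sin[of "k * x"] by (simp add: mult.assoc)
    then have "1 / 2 - cos (2 * k * x) / 2 = (cmod (complex_of_real (sin (k * x))))\<^sup>2"
      by (simp add: diff_divide_distrib)
    moreover have "((\<lambda>x. x / 2 - sin (2 * k * x) / (4 * k)) has_real_derivative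
        1 / 2 - cos (2 * k * x) / 2) (at x)"
      using k by (auto intro!: derivative_eq_intros)
    ultimately show "((\<lambda>x. x / 2 - sin (2 * k * x) / (4 * k)) has_vector_derivative (cmod (complex_of_real (sin (k * x))))\<^sup>2) (at x)"
      by (simp add: has_real_derivative_iff_has_vector_derivative)
  qed (intro continuous_intros)
  finally show "(norm (sine_mode L k))\<^sup>2 = L / 2" by (simp add: sin2)
  have "(norm (cosine_mode L k))\<^sup>2 = (LINT x:{0<..<L}|lborel. (cmod (complex_of_real (cos (k * x))))\<^sup>2)"
    unfolding cosine_mode_def by (intro norm_L2_restrict continuous_intros)
  also have "\<dots> = (L / 2 + sin (2 * k * L) / (4 * k)) - (0 / 2 + sin (2 * k * 0) / (4 * k))"
  proof (rule set_integral_FTC_Ioo[OF L])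
    fix x
    have "cos (2 * k * x) = 2 * (cos (k * x))\<^sup>2 - 1"
      using cos_double_cos[of "k * x"] by (simp add: mult.assoc)
    then have "1 / 2 + cos (2 * k * x) / 2 = (cmod (complex_of_real (cos (k * x))))\<^sup>2"
      by (simp add: diff_divide_distrib)
    moreover have "((\<lambda>x. x / 2 + sin (2 * k * x) / (4 * k)) has_real_derivative
        1 / 2 + cos (2 * k * x) / 2) (at x)"
      using k by (auto intro!: derivative_eq_intros)
    ultimately show "((\<lambda>x. x / 2 + sin (2 * k * x) / (4 * k)) has_vector_derivative (cmod (complex_of_real (cos (k * x))))\<^sup>2) (at x)"
      by (simp add: has_real_derivative_iff_has_vector_derivative)
  qed (intro continuous_intros)
  finally show "(norm (cosine_mode L k))\<^sup>2 = L / 2" by (simp add: sin2)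
qed

text \<open>Sines and cosines are distributed according to the boundary conditions, so that \<open>A1\<close>
  leaves these states invariant for fixed \<open>k\<close>.\<close>

definition mode_state :: "complex \<Rightarrow> complex \<Rightarrow> complex \<Rightarrow> complex \<Rightarrow> complex \<Rightarrow> complex \<Rightarrow>
    complex \<Rightarrow> complex \<Rightarrow> state" where
  "mode_state u v \<phi> \<Phi> \<psi> \<Psi> \<theta> q =
     (u *\<^sub>C cosine_mode L k, v *\<^sub>C cosine_mode L k, \<phi> *\<^sub>C cosine_mode L k, \<Phi> *\<^sub>C cosine_mode L k,
      \<psi> *\<^sub>C sine_mode L k, \<Psi> *\<^sub>C sine_mode L k, \<theta> *\<^sub>C sine_mode L k, q *\<^sub>C cosine_mode L k)"

lemma wderiv_modes:
  "wderiv L (c *\<^sub>C sine_mode L k) = (c * complex_of_real k) *\<^sub>C cosine_mode L k"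
  "wderiv L (c *\<^sub>C cosine_mode L k) = (- (c * complex_of_real k)) *\<^sub>C sine_mode L k"
  using sine_mode_H1_0 sine_mode_wderiv cosine_mode_H1_wderiv
  by (simp_all add: wderiv_scaleC scaleC_scaleC H1_0_def)

lemma modes_mem:
  "c *\<^sub>C sine_mode L k \<in> H1_0 L" "c *\<^sub>C sine_mode L k \<in> H1 L" "c *\<^sub>C sine_mode L k \<in> L2_on L"
  "c *\<^sub>C cosine_mode L k \<in> H1_mean_zero L" "c *\<^sub>C cosine_mode L k \<in> L2_mean_zero L"
  "c *\<^sub>C cosine_mode L k \<in> H1 L" "c *\<^sub>C cosine_mode L k \<in> L2_on L"
proof -
  show s: "c *\<^sub>C sine_mode L k \<in> H1_0 L"
    using complex_subspace_H1_0[of L] sine_mode_H1_0 by (simp add: complex_subspace_def)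
  then show s1: "c *\<^sub>C sine_mode L k \<in> H1 L" by (simp add: H1_0_def)
  show c: "c *\<^sub>C cosine_mode L k \<in> H1_mean_zero L"
    using complex_subspace_H1_mean_zero[of L] cosine_mode_H1_mean_zero by (simp add: complex_subspace_def)
  then show "c *\<^sub>C cosine_mode L k \<in> L2_mean_zero L" and c1: "c *\<^sub>C cosine_mode L k \<in> H1 L"
    by (simp_all add: H1_mean_zero_def)
  show "c *\<^sub>C sine_mode L k \<in> L2_on L" "c *\<^sub>C cosine_mode L k \<in> L2_on L"
    using s1 c1 by (auto dest: H1_D)
qed

lemma mode_state_in_dom: "mode_state u v \<phi> \<Phi> \<psi> \<Psi> \<theta> q \<in> dom_A1 L"
  by (simp add: mode_state_def dom_A1_def state_space_def modes_mem wderiv_modes H2_def)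

lemma combine_scaleC:
  fixes x :: "'a::complex_vector"
  shows "p *\<^sub>C x + q *\<^sub>C x = (p + q) *\<^sub>C x" "p *\<^sub>C x - q *\<^sub>C x = (p - q) *\<^sub>C x"
    "- (p *\<^sub>C x) = (- p) *\<^sub>C x" "r *\<^sub>R (p *\<^sub>C x) = (complex_of_real r * p) *\<^sub>C x"
  by (simp_all add: scaleC_add_left scaleC_minus_left scaleR_scaleC scaleC_scaleC)
    (metis add_diff_cancel_right' diff_add_cancel scaleC_add_left)

lemma A1_mode_state:
  fixes u v \<phi> \<Phi> \<psi> \<Psi> \<theta> q :: complex
  shows
  "A1 L \<rho> \<rho>\<^sub>1 \<rho>\<^sub>2 \<rho>\<^sub>3 \<alpha> \<kappa> b \<tau> \<sigma> \<beta> \<gamma> m (mode_state u v \<phi> \<Phi> \<psi> \<Psi> \<theta> q) = mode_state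
     v
     ((- \<alpha> * k\<^sup>2 * u + \<beta> * (\<phi> - u) - \<gamma> * v) / \<rho>)
     \<Phi>
     ((\<kappa> * k * (\<psi> - k * \<phi>) - \<beta> * (\<phi> - u) - m * k * \<theta>) / \<rho>\<^sub>1)
     \<Psi>
     ((- b * k\<^sup>2 * \<psi> - \<kappa> * (\<psi> - k * \<phi>) + m * \<theta>) / \<rho>\<^sub>2)
     ((k * q - m * (\<Psi> - k * \<Phi>)) / \<rho>\<^sub>3)
     ((- \<sigma> * q - k * \<theta>) / \<tau>)"
  by (simp add: A1_def mode_state_def wderiv_modes combine_scaleC)
    (simp add: field_simps power2_eq_square)

lemma mode_state_diff_scale:
  "mode_state u v \<phi> \<Phi> \<psi> \<Psi> \<theta> q - c *\<^sub>C mode_state u' v' \<phi>' \<Phi>' \<psi>' \<Psi>' \<theta>' q' =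
   mode_state (u - c * u') (v - c * v') (\<phi> - c * \<phi>') (\<Phi> - c * \<Phi>') (\<psi> - c * \<psi>')
     (\<Psi> - c * \<Psi>') (\<theta> - c * \<theta>') (q - c * q')"
  by (simp add: mode_state_def scaleC_prod_def scaleC_scaleC combine_scaleC)

lemma energy_norm_mode_state:
  fixes u v \<phi> \<Phi> \<psi> \<Psi> \<theta> q :: complex
  shows
  "energy_norm L \<rho> \<rho>\<^sub>1 \<rho>\<^sub>2 \<rho>\<^sub>3 \<alpha> \<kappa> b \<tau> \<beta> (mode_state u v \<phi> \<Phi> \<psi> \<Psi> \<theta> q) =
     sqrt ((\<rho> * (cmod v)\<^sup>2 + \<alpha> * (k * cmod u)\<^sup>2 + \<rho>\<^sub>1 * (cmod \<Phi>)\<^sup>2 + \<rho>\<^sub>2 * (cmod \<Psi>)\<^sup>2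
       + b * (k * cmod \<psi>)\<^sup>2 + \<beta> * (cmod (\<phi> - u))\<^sup>2 + \<kappa> * (cmod (\<psi> - k * \<phi>))\<^sup>2
       + \<rho>\<^sub>3 * (cmod \<theta>)\<^sup>2 + \<tau> * (cmod q)\<^sup>2) * (L / 2))"
  using k by (simp add: energy_norm_def mode_state_def wderiv_modes combine_scaleC norm_scaleC_L2
      norm_mult power_mult_distrib norm_modes algebra_simps)

end

section \<open>Quasimodes of the coupled system\<close>

lemma mode_state_cong:
  assumes "u = u'" "v = v'" "\<phi> = \<phi>'" "\<Phi> = \<Phi>'" "\<psi> = \<psi>'" "\<Psi> = \<Psi>'" "\<theta> = \<theta>'" "q = q'"
  shows "mode_state L k u v \<phi> \<Phi> \<psi> \<Psi> \<theta> q = mode_state L k u' v' \<phi>' \<Phi>' \<psi>' \<Psi>' \<theta>' q'"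
  using assms by simp

text \<open>After inserting the ansatz, the \<open>\<Phi>\<close>- and \<open>\<theta>\<close>-components are,
  up to terms of order \<open>1 / k\<^sup>2\<close>, the two linear equations for \<open>X\<close> and
  \<open>Y\<close>; the choice of \<open>s\<close> removes the leading term of the
  \<open>\<Psi>\<close>-component, and the choice of \<open>Z\<close> that of the \<open>q\<close>-component.
  The components \<open>u, \<phi>, \<psi>\<close> vanish since velocities are exact time derivatives.\<close>

lemma quasimode_residual:
  fixes L k s X Y :: real and Z :: complex and x :: state
  assumes Lk: "L > 0" "k > 0" "sin (k * L) = 0"
    and pos: "\<rho> > 0" "\<rho>\<^sub>1 > 0" "\<rho>\<^sub>2 > 0" "\<rho>\<^sub>3 > 0" "\<tau> > 0" "s > 0" "s\<^sup>2 = b / \<rho>\<^sub>2"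
    and eq_X: "(\<rho>\<^sub>1 * s\<^sup>2 - \<kappa>) * X - m * Y = - \<kappa>"
    and eq_Y: "m * X - (\<rho>\<^sub>3 - 1 / (s\<^sup>2 * \<tau>)) * Y = m"
  defines "Z \<equiv> \<i> * (Y / (s * \<tau>))"
  defines "x \<equiv> mode_state L k 0 0 (X / k\<^sup>2) (\<i> * (s * X / k)) (1 / k) (\<i> * s) (Y / k) (Z / k)"
  shows "A1 L \<rho> \<rho>\<^sub>1 \<rho>\<^sub>2 \<rho>\<^sub>3 \<alpha> \<kappa> b \<tau> \<sigma> \<beta> \<gamma> m x - (\<i> * complex_of_real (s * k)) *\<^sub>C x =
    mode_state L k 0 (complex_of_real (\<beta> * X / \<rho>) * (1 / k)\<^sup>2)
      0 (complex_of_real (- \<beta> * X / \<rho>\<^sub>1) * (1 / k)\<^sup>2)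
      0 (complex_of_real ((\<kappa> * X + m * Y - \<kappa>) / \<rho>\<^sub>2) * (1 / k)) 0 (- \<sigma> / \<tau> * Z * (1 / k))"
proof -
  have r4: "(\<kappa> * k * (1 / k - k * (X / k\<^sup>2)) - \<beta> * (X / k\<^sup>2) - m * k * (Y / k)) / \<rho>\<^sub>1 + s * k * (s * X / k)
      = - \<beta> * X / \<rho>\<^sub>1 * (1 / k)\<^sup>2"
  proof -
    have "(\<kappa> * k * (1 / k - k * (X / k\<^sup>2)) - \<beta> * (X / k\<^sup>2) - m * k * (Y / k)) / \<rho>\<^sub>1 + s * k * (s * X / k)
      = (\<kappa> + ((\<rho>\<^sub>1 * s\<^sup>2 - \<kappa>) * X - m * Y)) / \<rho>\<^sub>1 - \<beta> * X / \<rho>\<^sub>1 * (1 / k)\<^sup>2"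
      using Lk pos by (simp add: field_simps power2_eq_square)
    then show ?thesis by (simp add: eq_X)
  qed
  have r6: "(- b * k\<^sup>2 * (1 / k) - \<kappa> * (1 / k - k * (X / k\<^sup>2)) + m * (Y / k)) / \<rho>\<^sub>2 + s * k * s
      = (\<kappa> * X + m * Y - \<kappa>) / \<rho>\<^sub>2 * (1 / k)"
  proof -
    have "(- b * k\<^sup>2 * (1 / k) - \<kappa> * (1 / k - k * (X / k\<^sup>2)) + m * (Y / k)) / \<rho>\<^sub>2 + s * k * s
      = (\<kappa> * X + m * Y - \<kappa>) / \<rho>\<^sub>2 * (1 / k) + k * (s\<^sup>2 - b / \<rho>\<^sub>2)"
      using Lk pos(3) by (simp add: field_simps power2_eq_square)
    then show ?thesis by (simp add: pos)
  qed
  have r7: "(k * (Y / (s * \<tau>) / k) - m * (s - k * (s * X / k))) / \<rho>\<^sub>3 - s * k * (Y / k) = 0"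
  proof -
    have "(k * (Y / (s * \<tau>) / k) - m * (s - k * (s * X / k))) / \<rho>\<^sub>3 - s * k * (Y / k)
      = s * ((m * X - (\<rho>\<^sub>3 - 1 / (s\<^sup>2 * \<tau>)) * Y) - m) / \<rho>\<^sub>3"
      using Lk pos(1-6) by (simp add: field_simps power2_eq_square)
    then show ?thesis by (simp add: eq_Y)
  qed
  have r8: "k * (Y / k) / \<tau> = s * k * (Y / (s * \<tau>) / k)"
    using Lk pos by (simp add: field_simps)
  have ii: "\<i> * p * (\<i> * q) = - (p * q)" for p q
    by (simp add: algebra_simps)
  let ?c = complex_of_real
  have nz: "k \<noteq> 0" using Lk by simp
  show ?thesis
    unfolding x_def A1_mode_state[OF Lk] mode_state_diff_scale[OF Lk]
  proof (rule mode_state_cong, goal_cases)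
    case 1
    show ?case by simp
  next
    case 2
    show ?case by (simp add: power_divide)
  next
    case 3
    show ?case using nz by (simp add: power2_eq_square)
  next
    case 4
    show ?case using nz arg_cong[OF r4, of ?c] by (simp add: ii)
  next
    case 5
    show ?case using nz by simp
  next
    case 6
    show ?case using nz arg_cong[OF r6, of ?c] by (simp add: ii)
  next
    case 7
    have "?c (k * (Y / (s * \<tau>) / k) - m * (s - k * (s * X / k))) / ?c \<rho>\<^sub>3 = ?c (s * k * (Y / k))"
      using arg_cong[OF r7, of ?c] by simp
    from arg_cong[OF this, of "(*) \<i>"]
    show ?case using nz unfolding Z_def by (simp add: algebra_simps)
  next
    case 8
    have "\<i> * ?c (s * k) * (Z / ?c k) = - ?c (k * (Y / k) / \<tau>)"
      unfolding r8 Z_def by (simp add: ii)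
    then show ?case using nz by (simp add: diff_divide_distrib)
  qed
qed

lemma energy_norm_residual:
  assumes "L > 0" "k > 0" "sin (k * L) = 0"
  shows "energy_norm L \<rho> \<rho>\<^sub>1 \<rho>\<^sub>2 \<rho>\<^sub>3 \<alpha> \<kappa> b \<tau> \<beta> (mode_state L k 0 v 0 \<Phi> 0 \<Psi> 0 q) =
    sqrt ((\<rho> * (cmod v)\<^sup>2 + \<rho>\<^sub>1 * (cmod \<Phi>)\<^sup>2 + \<rho>\<^sub>2 * (cmod \<Psi>)\<^sup>2 + \<tau> * (cmod q)\<^sup>2) * (L / 2))"
  using energy_norm_mode_state[OF assms] by simp

lemma energy_norm_lower_bound:
  fixes u v \<phi> \<Phi> \<psi> \<Psi> \<theta> q :: complex
  assumes "L > 0" "k > 0" "sin (k * L) = 0"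
    and "\<rho> > 0" "\<rho>\<^sub>1 > 0" "\<rho>\<^sub>2 > 0" "\<rho>\<^sub>3 > 0" "\<alpha> > 0" "\<kappa> > 0" "b > 0" "\<tau> > 0" "\<beta> > 0"
  shows "sqrt (\<rho>\<^sub>2 * (cmod \<Psi>)\<^sup>2 * (L / 2))
    \<le> energy_norm L \<rho> \<rho>\<^sub>1 \<rho>\<^sub>2 \<rho>\<^sub>3 \<alpha> \<kappa> b \<tau> \<beta> (mode_state L k u v \<phi> \<Phi> \<psi> \<Psi> \<theta> q)"
  unfolding energy_norm_mode_state[OF assms(1-3)]
proof (intro real_sqrt_le_mono mult_right_mono)
  have "0 \<le> \<rho> * (cmod v)\<^sup>2" "0 \<le> \<alpha> * (k * cmod u)\<^sup>2" "0 \<le> \<rho>\<^sub>1 * (cmod \<Phi>)\<^sup>2"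
    "0 \<le> b * (k * cmod \<psi>)\<^sup>2" "0 \<le> \<beta> * (cmod (\<phi> - u))\<^sup>2" "0 \<le> \<kappa> * (cmod (\<psi> - k * \<phi>))\<^sup>2"
    "0 \<le> \<rho>\<^sub>3 * (cmod \<theta>)\<^sup>2" "0 \<le> \<tau> * (cmod q)\<^sup>2"
    using assms by auto
  then show "\<rho>\<^sub>2 * (cmod \<Psi>)\<^sup>2 \<le> \<rho> * (cmod v)\<^sup>2 + \<alpha> * (k * cmod u)\<^sup>2 + \<rho>\<^sub>1 * (cmod \<Phi>)\<^sup>2 + \<rho>\<^sub>2 * (cmod \<Psi>)\<^sup>2
       + b * (k * cmod \<psi>)\<^sup>2 + \<beta> * (cmod (\<phi> - u))\<^sup>2 + \<kappa> * (cmod (\<psi> - k * \<phi>))\<^sup>2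
       + \<rho>\<^sub>3 * (cmod \<theta>)\<^sup>2 + \<tau> * (cmod q)\<^sup>2"
    by linarith
qed (use assms in auto)

text \<open>Write \<open>d = \<rho>\<^sub>3 - \<rho>\<^sub>2 / (b \<tau>)\<close>. The second equation is
  \<open>m\<^sup>2 = - \<kappa> d\<close>; substituted into the first one it leaves \<open>\<rho>\<^sub>1 d =
  0\<close>, hence \<open>m = 0\<close>.\<close>

lemma chi_not_both_zero:
  fixes \<rho>\<^sub>1 \<rho>\<^sub>2 \<rho>\<^sub>3 \<kappa> b \<tau> m :: real
  assumes "\<rho>\<^sub>1 > 0" "\<rho>\<^sub>2 > 0" "\<kappa> > 0" "b > 0" "\<tau> > 0" "m \<noteq> 0"
    and \<chi>\<^sub>0: "\<kappa> * (\<rho>\<^sub>2 / b - \<rho>\<^sub>1 / \<kappa>) * (\<rho>\<^sub>3 - \<rho>\<^sub>2 / (b * \<tau>)) + m\<^sup>2 * \<rho>\<^sub>2 / b = 0"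
    and \<chi>\<^sub>1: "- m\<^sup>2 - \<kappa> * \<rho>\<^sub>3 + \<kappa> * \<rho>\<^sub>2 / (\<tau> * b) = 0"
  shows False
proof -
  define d where "d = \<rho>\<^sub>3 - \<rho>\<^sub>2 / (b * \<tau>)"
  have m2: "m\<^sup>2 = - \<kappa> * d"
    using \<chi>\<^sub>1 by (simp add: d_def algebra_simps)
  have "\<kappa> * (\<rho>\<^sub>2 / b - \<rho>\<^sub>1 / \<kappa>) * d + (- \<kappa> * d) * \<rho>\<^sub>2 / b = 0"
    using \<chi>\<^sub>0 unfolding m2 d_def .
  moreover have "\<kappa> * (\<rho>\<^sub>2 / b - \<rho>\<^sub>1 / \<kappa>) * d + (- \<kappa> * d) * \<rho>\<^sub>2 / b = - \<rho>\<^sub>1 * d"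
    using assms(3,4) by (simp add: field_simps)
  ultimately have "d = 0" using assms(1) by simp
  then show False using m2 assms(6) by simp
qed

theorem theorem2p3:
  fixes L \<rho> \<rho>\<^sub>1 \<rho>\<^sub>2 \<rho>\<^sub>3 \<alpha> \<kappa> b \<tau> \<sigma> \<beta> \<gamma> m \<chi>\<^sub>0 \<chi>\<^sub>1 :: real
    and T :: "real \<Rightarrow> state \<Rightarrow> state"
  assumes "L > 0" and "\<rho> > 0" and "\<rho>\<^sub>1 > 0" and "\<rho>\<^sub>2 > 0" and "\<rho>\<^sub>3 > 0" and "\<alpha> > 0" and "\<kappa> > 0"
    and "b > 0" and "\<tau> > 0" and "\<sigma> > 0" and "\<beta> > 0" and "\<gamma> > 0" and "m \<noteq> 0"
    and "\<chi>\<^sub>0 = \<kappa> * (\<rho>\<^sub>2 / b - \<rho>\<^sub>1 / \<kappa>) * (\<rho>\<^sub>3 - \<rho>\<^sub>2 / (b * \<tau>)) + m\<^sup>2 * \<rho>\<^sub>2 / b"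
    and "\<chi>\<^sub>1 = - m\<^sup>2 - \<kappa> * \<rho>\<^sub>3 + \<kappa> * \<rho>\<^sub>2 / (\<tau> * b)"
    and "\<chi>\<^sub>0 \<noteq> 0 \<or> (\<chi>\<^sub>0 = 0 \<and> \<chi>\<^sub>1 = 0)"
    and "generates (state_space L) (energy_norm L \<rho> \<rho>\<^sub>1 \<rho>\<^sub>2 \<rho>\<^sub>3 \<alpha> \<kappa> b \<tau> \<beta>) (dom_A1 L)
           (A1 L \<rho> \<rho>\<^sub>1 \<rho>\<^sub>2 \<rho>\<^sub>3 \<alpha> \<kappa> b \<tau> \<sigma> \<beta> \<gamma> m) T"
  shows "\<not> exponentially_stable (state_space L)
           (energy_norm L \<rho> \<rho>\<^sub>1 \<rho>\<^sub>2 \<rho>\<^sub>3 \<alpha> \<kappa> b \<tau> \<beta>) T"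
proof
  let ?N = "energy_norm L \<rho> \<rho>\<^sub>1 \<rho>\<^sub>2 \<rho>\<^sub>3 \<alpha> \<kappa> b \<tau> \<beta>"
  let ?A = "A1 L \<rho> \<rho>\<^sub>1 \<rho>\<^sub>2 \<rho>\<^sub>3 \<alpha> \<kappa> b \<tau> \<sigma> \<beta> \<gamma> m"
  assume stable: "exponentially_stable (state_space L) ?N T"
  interpret seminormed_subspace "state_space L" ?N
    by (rule energy_seminorm) (use assms in auto)
  obtain K where K: "\<And>x \<mu>. x \<in> dom_A1 L \<Longrightarrow> ?N x \<le> K * ?N (?A x - (\<i> * complex_of_real \<mu>) *\<^sub>C x)"
    using exponentially_stable_imp_resolvent_bound[OF assms(17) stable] by blast
  have "\<chi>\<^sub>0 \<noteq> 0"
    using assms chi_not_both_zero[of \<rho>\<^sub>1 \<rho>\<^sub>2 \<kappa> b \<tau> m \<rho>\<^sub>3] by auto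
  define s where "s = sqrt (b / \<rho>\<^sub>2)"
  have s: "s > 0" "s\<^sup>2 = b / \<rho>\<^sub>2" using assms by (auto simp: s_def)
  define a where "a = \<rho>\<^sub>1 * s\<^sup>2 - \<kappa>"
  define d where "d = \<rho>\<^sub>3 - 1 / (s\<^sup>2 * \<tau>)"
  have "\<chi>\<^sub>0 * b / \<rho>\<^sub>2 = m\<^sup>2 - a * d"
    unfolding assms(14) a_def d_def s(2) using assms(1-13) by (simp add: field_simps power2_eq_square)
  with \<open>\<chi>\<^sub>0 \<noteq> 0\<close> have D: "m\<^sup>2 - a * d \<noteq> 0" using assms by auto
  \<comment> \<open>Cramer's rule for the system that cancels the terms of order one\<close>
  define X where "X = (\<kappa> * d + m\<^sup>2) / (m\<^sup>2 - a * d)"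
  define Y where "Y = m * (a + \<kappa>) / (m\<^sup>2 - a * d)"
  have XY: "a * X - m * Y = - \<kappa>" "m * X - d * Y = m"
  proof -
    have "a * X - m * Y = (a * (\<kappa> * d + m\<^sup>2) - m * (m * (a + \<kappa>))) / (m\<^sup>2 - a * d)"
      by (simp add: X_def Y_def diff_divide_distrib)
    also have "a * (\<kappa> * d + m\<^sup>2) - m * (m * (a + \<kappa>)) = - \<kappa> * (m\<^sup>2 - a * d)"
      by (simp add: algebra_simps power2_eq_square)
    finally show "a * X - m * Y = - \<kappa>" using D by simp
    have "m * X - d * Y = (m * (\<kappa> * d + m\<^sup>2) - d * (m * (a + \<kappa>))) / (m\<^sup>2 - a * d)"
      by (simp add: X_def Y_def diff_divide_distrib)
    also have "m * (\<kappa> * d + m\<^sup>2) - d * (m * (a + \<kappa>)) = m * (m\<^sup>2 - a * d)"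
      by (simp add: algebra_simps power2_eq_square)
    finally show "m * X - d * Y = m" using D by simp
  qed
  define Z where "Z = \<i> * complex_of_real (Y / (s * \<tau>))"
  define k where "k n = real (Suc n) * pi / L" for n
  have k: "k n > 0" "sin (k n * L) = 0" for n
    using assms(1) sin_npi[of "Suc n"] by (auto simp: k_def simp del: of_nat_Suc)
  have "(\<lambda>n. L / pi * inverse (real (Suc n))) \<longlonglongrightarrow> L / pi * 0"
    by (intro tendsto_intros LIMSEQ_inverse_real_of_nat)
  then have k_lim: "(\<lambda>n. complex_of_real (1 / k n)) \<longlonglongrightarrow> 0"
    using tendsto_of_real[where ?'a = complex] by (fastforce simp: k_def field_simps)
  define x where "x n = mode_state L (k n) 0 0 (X / (k n)\<^sup>2) (\<i> * (s * X / k n)) (1 / k n) (\<i> * s)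
    (Y / k n) (Z / k n)" for n
  define r where "r n = ?N (?A (x n) - (\<i> * complex_of_real (s * k n)) *\<^sub>C x n)" for n
  have r_eq: "r n = sqrt ((\<rho> * (cmod (complex_of_real (\<beta> * X / \<rho>) * (complex_of_real (1 / k n))\<^sup>2))\<^sup>2
      + \<rho>\<^sub>1 * (cmod (complex_of_real (- \<beta> * X / \<rho>\<^sub>1) * (complex_of_real (1 / k n))\<^sup>2))\<^sup>2
      + \<rho>\<^sub>2 * (cmod (complex_of_real ((\<kappa> * X + m * Y - \<kappa>) / \<rho>\<^sub>2) * complex_of_real (1 / k n)))\<^sup>2
      + \<tau> * (cmod (- \<sigma> / \<tau> * Z * complex_of_real (1 / k n)))\<^sup>2) * (L / 2))" for n
    unfolding r_def x_def Z_def
    by (subst quasimode_residual[OF assms(1) k(1,2) assms(2-5,9) s XY[unfolded a_def d_def]])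
      (simp add: energy_norm_residual[OF assms(1) k(1,2)])
  have "r \<longlonglongrightarrow> sqrt ((\<rho> * (cmod (complex_of_real (\<beta> * X / \<rho>) * 0\<^sup>2))\<^sup>2
      + \<rho>\<^sub>1 * (cmod (complex_of_real (- \<beta> * X / \<rho>\<^sub>1) * 0\<^sup>2))\<^sup>2
      + \<rho>\<^sub>2 * (cmod (complex_of_real ((\<kappa> * X + m * Y - \<kappa>) / \<rho>\<^sub>2) * 0))\<^sup>2
      + \<tau> * (cmod (- \<sigma> / \<tau> * Z * 0))\<^sup>2) * (L / 2))"
    unfolding r_eq[abs_def] by (intro tendsto_intros k_lim)
  then have "(\<lambda>n. K * r n) \<longlonglongrightarrow> K * 0"
    by (intro tendsto_mult_left) simp
  moreover have "sqrt (b * (L / 2)) \<le> K * r n" for n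
  proof -
    have "sqrt (\<rho>\<^sub>2 * (cmod (\<i> * s))\<^sup>2 * (L / 2)) \<le> ?N (x n)"
      unfolding x_def by (rule energy_norm_lower_bound[OF assms(1) k(1,2)]) (use assms in auto)
    also have "\<dots> \<le> K * r n"
      unfolding r_def by (rule K) (simp add: x_def mode_state_in_dom[OF assms(1) k(1,2)])
    finally show ?thesis
      using s assms by (simp add: norm_mult)
  qed
  ultimately have "sqrt (b * (L / 2)) \<le> K * 0"
    by (intro LIMSEQ_le_const) auto
  then show False using mult_pos_pos[OF assms(8,1)] by simp
qed

end
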